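(* Let $B$ be the second Basilica group of the Grigorchuk--Erschler group. The Hausdorff dimension of the closure $\overline{B}$ of $B$ in $\mathrm{Aut}\,T$ is $\frac{31}{32}$.
   Context: Let $T$ be the binary rooted tree with vertices the finite words over $X=\{0,1\}$ (root the empty word, each $v$ joined to $v0,v1$), and $\mathrm{Aut}\,T$ its group of root-fixing automorphisms, acting on the left. The section $g|_v$ of $g\in\mathrm{Aut}\,T$ at a vertex $v$ is defined by $g(vw)=g(v)g|_v(w)$. One writes $g=(g|_0,g|_1)\sigma$ with $\sigma\in\mathrm{Sym}(\{0,1\})$ the action on the first level; $(x,y)$ denotes the automorphism fixing $0,1$ with sections $x$ at $0$ and $y$ at $1$; $\tau$ is the transposition of $0$ and $1$. The second Basilica group $B$ of the Grigorchuk--Erschler group is the subgroup of $\mathrm{Aut}\,T$ generated by $a=(1,1)\tau$, $\alpha=(a,1)$, $c_0=(c_1,1)$, $c_1=(c_2,1)$, $c_2=(c_3,1)$, $c_3=(c_0,\alpha)$. $\mathrm{St}_G(n)$ is the subgroup of $G\le\mathrm{Aut}\,T$ of elements fixing every word of length $n$. $\mathrm{Aut}\,T$ is a profinite group with the level stabilisers $\mathrm{St}_{\mathrm{Aut}\,T}(n)$ as a base of neighbourhoods of the identity, and Hausdorff dimension is taken with respect to this filtration, so that the Hausdorff dimension of $\overline{B}$ in $\mathrm{Aut}\,T$ equals $$\liminf_{n\to\infty}\frac{\log_2|B:\mathrm{St}_B(n)|}{\log_2|\mathrm{Aut}\,T:\mathrm{St}_{\mathrm{Aut}\,T}(n)|}=\liminf_{n\to\infty}\frac{\log_2|B:\mathrm{St}_B(n)|}{2^n-1}.$$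 *)

theory Defs
  imports "HOL-Analysis.Analysis" "HOL-Algebra.Generated_Groups"
begin

section \<open>The binary rooted tree and its automorphism group\<close>

text \<open>
  Vertices are words over the alphabet \<open>{0,1}\<close>, the letters being encoded as
  \<open>0 = False\<close> and \<open>1 = True\<close>; the root is the empty word.
\<close>

type_synonym word = "bool list"

definition tree_adj :: "word \<Rightarrow> word \<Rightarrow> bool" where
  "tree_adj u v \<longleftrightarrow> (\<exists>x. v = u @ [x] \<or> u = v @ [x])"

definition tree_auts :: "(word \<Rightarrow> word) set" where
  "tree_auts = {g. bij g \<and> g [] = [] \<and> (\<forall>u v. tree_adj (g u) (g v) \<longleftrightarrow> tree_adj u v)}"

text \<open>Multiplication is composition of maps, i.e. the group acts on the left.\<close>

definition AutT :: "(word \<Rightarrow> word) monoid" where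
  "AutT = \<lparr>carrier = tree_auts, mult = (\<lambda>g h. g \<circ> h), one = id\<rparr>"

definition level_stab :: "(word \<Rightarrow> word) set \<Rightarrow> nat \<Rightarrow> (word \<Rightarrow> word) set" where
  "level_stab G n = {g \<in> G. \<forall>w. length w = n \<longrightarrow> g w = w}"

text \<open>
  The topology on \<open>AutT\<close> with the level stabilisers as a base of neighbourhoods of the identity:
  it is generated by the left cosets of the level stabilisers.
\<close>

definition aut_topology :: "(word \<Rightarrow> word) topology" where
  "aut_topology = topology_generated_by
     {g <#\<^bsub>AutT\<^esub> level_stab (carrier AutT) n | g n. g \<in> carrier AutT}"


section \<open>The second Basilica group of the Grigorchuk--Erschler group\<close>

text \<open>The automorphism \<open>(x,y)\<close>, which fixes both letters and has sections \<open>x\<close> at 0, \<open>y\<close> at 1.\<close>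

fun tpair :: "(word \<Rightarrow> word) \<Rightarrow> (word \<Rightarrow> word) \<Rightarrow> word \<Rightarrow> word" where
  "tpair x y [] = []"
| "tpair x y (False # w) = False # x w"
| "tpair x y (True # w) = True # y w"

fun gen_a :: "word \<Rightarrow> word" where
  "gen_a [] = []"
| "gen_a (x # w) = (\<not> x) # w"

definition gen_alpha :: "word \<Rightarrow> word" where
  "gen_alpha = tpair gen_a id"

text \<open>
  The recursion \<open>c\<^sub>0 = (c\<^sub>1,1)\<close>, \<open>c\<^sub>1 = (c\<^sub>2,1)\<close>, \<open>c\<^sub>2 = (c\<^sub>3,1)\<close>, \<open>c\<^sub>3 = (c\<^sub>0,\<alpha>)\<close> is here spelt out
  on words; the lemmas \<open>gen_c0_eq\<close> to \<open>gen_c3_eq\<close> below recover it in the wreath notation.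
\<close>

fun gen_c0 :: "word \<Rightarrow> word"
  and gen_c1 :: "word \<Rightarrow> word"
  and gen_c2 :: "word \<Rightarrow> word"
  and gen_c3 :: "word \<Rightarrow> word" where
  "gen_c0 [] = []"
| "gen_c0 (False # w) = False # gen_c1 w"
| "gen_c0 (True # w) = True # w"
| "gen_c1 [] = []"
| "gen_c1 (False # w) = False # gen_c2 w"
| "gen_c1 (True # w) = True # w"
| "gen_c2 [] = []"
| "gen_c2 (False # w) = False # gen_c3 w"
| "gen_c2 (True # w) = True # w"
| "gen_c3 [] = []"
| "gen_c3 (False # w) = False # gen_c0 w"
| "gen_c3 (True # w) = True # gen_alpha w"

definition second_Basilica_GE :: "(word \<Rightarrow> word) set" where
  "second_Basilica_GE = generate AutT {gen_a, gen_alpha, gen_c0, gen_c1, gen_c2, gen_c3}"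


section \<open>Hausdorff dimension\<close>

text \<open>
  Hausdorff dimension of subsets of a set \<open>M\<close> carrying a metric \<open>d\<close>. Only sets of bounded diameter
  occur in covers, so the real-valued supremum in \<open>diam_wrt\<close> is a genuine one. The dimension is
  read off from the exponents \<open>s > 0\<close> only, where \<open>0 powr s = 0\<close> is the right convention.
\<close>

definition diam_wrt :: "('a \<Rightarrow> 'a \<Rightarrow> real) \<Rightarrow> 'a set \<Rightarrow> real" where
  "diam_wrt d U = (if U = {} then 0 else (SUP (x, y) \<in> U \<times> U. d x y))"

definition delta_covers :: "'a set \<Rightarrow> ('a \<Rightarrow> 'a \<Rightarrow> real) \<Rightarrow> real \<Rightarrow> 'a set \<Rightarrow> (nat \<Rightarrow> 'a set) set" where
  "delta_covers M d \<delta> A =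
     {U. A \<subseteq> (\<Union>i. U i) \<and> (\<forall>i. U i \<subseteq> M \<and> (\<forall>x \<in> U i. \<forall>y \<in> U i. d x y \<le> \<delta>))}"

definition hausdorff_measure :: "'a set \<Rightarrow> ('a \<Rightarrow> 'a \<Rightarrow> real) \<Rightarrow> real \<Rightarrow> 'a set \<Rightarrow> ennreal" where
  "hausdorff_measure M d s A =
     (SUP \<delta> \<in> {0<..}. INF U \<in> delta_covers M d \<delta> A. \<Sum>i. ennreal (diam_wrt d (U i) powr s))"

definition hausdorff_dim :: "'a set \<Rightarrow> ('a \<Rightarrow> 'a \<Rightarrow> real) \<Rightarrow> 'a set \<Rightarrow> ereal" where
  "hausdorff_dim M d A = Inf (ereal ` {s. 0 < s \<and> hausdorff_measure M d s A = 0})"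

text \<open>
  The metric on a group \<open>G\<close> defined by a filtration \<open>S\<close> of \<open>G\<close> by subgroups of finite index
  (Barnea--Shalev): the distance of \<open>g\<close> and \<open>h\<close> is the infimum of \<open>1 / |G : S n|\<close> over those \<open>n\<close>
  for which \<open>g\<close> and \<open>h\<close> lie in the same left coset of \<open>S n\<close>.
\<close>

definition filtration_dist :: "('a, 'b) monoid_scheme \<Rightarrow> (nat \<Rightarrow> 'a set) \<Rightarrow> 'a \<Rightarrow> 'a \<Rightarrow> real" where
  "filtration_dist G S g h =
     Inf {1 / real (card (rcosets\<^bsub>G\<^esub> (S n))) | n. inv\<^bsub>G\<^esub> g \<otimes>\<^bsub>G\<^esub> h \<in> S n}"

definition hausdorff_dim_AutT :: "(word \<Rightarrow> word) set \<Rightarrow> ereal" where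
  "hausdorff_dim_AutT =
     hausdorff_dim (carrier AutT) (filtration_dist AutT (level_stab (carrier AutT)))"


section \<open>Basic facts\<close>

lemma gen_c0_eq: "gen_c0 = tpair gen_c1 id"
  and gen_c1_eq: "gen_c1 = tpair gen_c2 id"
  and gen_c2_eq: "gen_c2 = tpair gen_c3 id"
  and gen_c3_eq: "gen_c3 = tpair gen_c0 gen_alpha"
proof -
  have *: "f = tpair x y" if "f [] = []" "\<And>w. f (False # w) = False # x w"
    "\<And>w. f (True # w) = True # y w" for f x y
  proof
    fix w show "f w = tpair x y w"
      by (cases "(x, y, w)" rule: tpair.cases) (auto simp: that)
  qed
  show "gen_c0 = tpair gen_c1 id" "gen_c1 = tpair gen_c2 id" "gen_c2 = tpair gen_c3 id"
    "gen_c3 = tpair gen_c0 gen_alpha"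
    by (rule *; simp)+
qed

lemma bij_tree_auts: "g \<in> tree_auts \<Longrightarrow> bij g"
  by (simp add: tree_auts_def)

lemma group_AutT: "group AutT"
proof (rule groupI)
  fix x assume "x \<in> carrier AutT"
  then have x: "x \<in> tree_auts" by (simp add: AutT_def)
  then have b: "bij x" by (rule bij_tree_auts)
  then have "x (inv_into UNIV x v) = v" for v
    by (simp add: bij_is_surj surj_f_inv_f)
  moreover have "inv_into UNIV x [] = []"
    using x b by (metis (mono_tags, lifting) bij_inv_eq_iff mem_Collect_eq tree_auts_def)
  ultimately have "inv_into UNIV x \<in> tree_auts"
    using x b unfolding tree_auts_def
    by (auto simp: bij_imp_bij_inv) (metis)+
  moreover have "inv_into UNIV x \<circ> x = id"
    using b by (simp add: bij_is_inj)
  ultimately show "\<exists>y\<in>carrier AutT. y \<otimes>\<^bsub>AutT\<^esub> x = \<one>\<^bsub>AutT\<^esub>"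
    by (auto simp: AutT_def)
qed (auto simp: AutT_def tree_auts_def bij_comp o_assoc)

lemma tree_adj_Nil: "tree_adj [] v \<longleftrightarrow> length v = 1" "tree_adj v [] \<longleftrightarrow> length v = 1"
  by (auto simp: tree_adj_def length_Suc_conv)

lemma tree_adj_Cons: "tree_adj (x # u) (y # v) \<longleftrightarrow> x = y \<and> tree_adj u v"
  by (auto simp: tree_adj_def)

lemma tree_auts_first_level:
  assumes "\<And>w. s (s w) = (w :: bool)"
    and "\<And>x. p x \<in> tree_auts" and len: "\<And>x w. length (p x w) = length w"
    and g: "g [] = []" "\<And>x w. g (x # w) = s x # p x w"
  shows "g \<in> tree_auts" "length (g w) = length w"
proof -
  have s: "s x = s y \<longleftrightarrow> x = y" for x y
    using arg_cong[of "s x" "s y" s] assms(1)[of x] assms(1)[of y] by auto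
  have p: "bij (p x)" "tree_adj (p x u) (p x v) \<longleftrightarrow> tree_adj u v" for x u v
    using assms(2)[of x] by (auto simp: tree_auts_def)
  have leng: "length (g w) = length w" for w
    by (cases w) (auto simp: g len)
  then show "length (g w) = length w" .
  have "inj g"
  proof (rule injI)
    fix u v assume "g u = g v"
    then show "u = v"
      by (cases u; cases v) (auto simp: g s dest: bij_is_inj[OF p(1), THEN injD])
  qed
  moreover have "\<exists>u. g u = v" for v
  proof (cases v)
    case Nil then show ?thesis using g by blast
  next
    case (Cons y w)
    obtain u where "p (s y) u = w" using p(1) by (metis bij_pointE)
    then have "g (s y # u) = v" using Cons assms(1) by (simp add: g)
    then show ?thesis by blast
  qed
  then have "surj g" unfolding surj_def by metis
  moreover have "tree_adj (g u) (g v) \<longleftrightarrow> tree_adj u v" for u v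
    by (cases u; cases v) (auto simp: g s p tree_adj_Cons tree_adj_Nil len)
  ultimately show "g \<in> tree_auts" using g by (auto simp: tree_auts_def bij_def)
qed

lemma id_tree_auts: "id \<in> tree_auts"
  by (simp add: tree_auts_def)

lemma gen_a_tree_auts: "gen_a \<in> tree_auts" "length (gen_a w) = length w"
  using tree_auts_first_level[of Not "\<lambda>_. id" gen_a] id_tree_auts by auto

lemma tpair_tree_auts:
  assumes "x \<in> tree_auts" "y \<in> tree_auts"
    "\<And>w. length (x w) = length w" "\<And>w. length (y w) = length w"
  shows "tpair x y \<in> tree_auts" "length (tpair x y w) = length w"
proof -
  have eq: "tpair x y (b # w) = b # (if b then y else x) w" for b w
    by (cases b) auto
  show "tpair x y \<in> tree_auts" "length (tpair x y w) = length w"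
    using tree_auts_first_level[of "\<lambda>b. b" "\<lambda>b. if b then y else x" "tpair x y"] assms eq by auto
qed

lemma gen_alpha_tree_auts: "gen_alpha \<in> tree_auts" "length (gen_alpha w) = length w"
  unfolding gen_alpha_def
  using tpair_tree_auts[of gen_a id] gen_a_tree_auts id_tree_auts by auto

lemma gen_c_length:
  "length (gen_c0 w) = length w \<and> length (gen_c1 w) = length w \<and>
   length (gen_c2 w) = length w \<and> length (gen_c3 w) = length w"
proof (induction w)
  case (Cons b w)
  then show ?case by (cases b) (auto simp: gen_alpha_tree_auts)
qed auto

lemma gen_c_inj:
  "(gen_c0 u = gen_c0 v \<longleftrightarrow> u = v) \<and> (gen_c1 u = gen_c1 v \<longleftrightarrow> u = v) \<and>
   (gen_c2 u = gen_c2 v \<longleftrightarrow> u = v) \<and> (gen_c3 u = gen_c3 v \<longleftrightarrow> u = v)"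
proof (induction u arbitrary: v)
  case Nil
  have len: "length (gen_c0 v) = length v" "length (gen_c1 v) = length v"
    "length (gen_c2 v) = length v" "length (gen_c3 v) = length v"
    using gen_c_length[of v] by auto
  show ?case
  proof (cases v)
    case (Cons c w)
    have "g v \<noteq> []" if "length (g v) = length v" for g :: "word \<Rightarrow> word"
      using that Cons by force
    then show ?thesis using len Cons by (metis gen_c0.simps(1) gen_c1.simps(1)
        gen_c2.simps(1) gen_c3.simps(1))
  qed simp
next
  case (Cons b u)
  have inj: "inj gen_alpha" using bij_tree_auts gen_alpha_tree_auts(1) bij_is_inj by blast
  show ?case
  proof (cases v)
    case (Cons c w)
    then show ?thesis using Cons.IH[of w] inj_eq[OF inj, of u w] by (cases b; cases c) auto
  qed (cases b; simp)
qed

lemma gen_c_surj: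
  "(\<exists>u. gen_c0 u = v) \<and> (\<exists>u. gen_c1 u = v) \<and> (\<exists>u. gen_c2 u = v) \<and> (\<exists>u. gen_c3 u = v)"
proof (induction v)
  case Nil
  show ?case by (intro conjI exI[of _ "[]"]) auto
next
  case (Cons b v)
  have *: "\<exists>u. g u = b # v" if "g x = True # v" "g y = False # v" for g :: "word \<Rightarrow> word" and x y
    using that by (cases b) auto
  obtain u where u: "gen_alpha u = v"
    using bij_tree_auts[OF gen_alpha_tree_auts(1)] by (metis bij_pointE)
  obtain u0 u1 u2 u3 where
    "gen_c0 u0 = v" "gen_c1 u1 = v" "gen_c2 u2 = v" "gen_c3 u3 = v"
    using Cons.IH by blast
  then show ?case
    using u *[of gen_c0 "True # v" "False # u1"] *[of gen_c1 "True # v" "False # u2"]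
      *[of gen_c2 "True # v" "False # u3"] *[of gen_c3 "True # u" "False # u0"]
    by simp
qed

lemma gen_c_adj:
  "(tree_adj (gen_c0 u) (gen_c0 v) \<longleftrightarrow> tree_adj u v) \<and>
   (tree_adj (gen_c1 u) (gen_c1 v) \<longleftrightarrow> tree_adj u v) \<and>
   (tree_adj (gen_c2 u) (gen_c2 v) \<longleftrightarrow> tree_adj u v) \<and>
   (tree_adj (gen_c3 u) (gen_c3 v) \<longleftrightarrow> tree_adj u v)"
proof (induction u arbitrary: v)
  case Nil
  then show ?case by (simp add: tree_adj_Nil gen_c_length)
next
  case (Cons b u)
  have alpha: "tree_adj (gen_alpha u) (gen_alpha w) \<longleftrightarrow> tree_adj u w" for w
    using gen_alpha_tree_auts(1) by (simp add: tree_auts_def)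
  show ?case
  proof (cases v)
    case Nil
    then show ?thesis
      by (simp only: tree_adj_Nil gen_c0.simps(1) gen_c1.simps(1) gen_c2.simps(1) gen_c3.simps(1)
          gen_c_length simp_thms)
  next
    case (Cons c w)
    then show ?thesis
      using Cons.IH[of w] alpha[of w] by (cases b; cases c) (simp_all add: tree_adj_Cons)
  qed
qed

lemma gens_in_AutT: "{gen_a, gen_alpha, gen_c0, gen_c1, gen_c2, gen_c3} \<subseteq> carrier AutT"
proof -
  have *: "g \<in> tree_auts" if "\<And>u v. tree_adj (g u) (g v) \<longleftrightarrow> tree_adj u v"
    "\<And>u v. g u = g v \<longleftrightarrow> u = v" "\<And>v. \<exists>u. g u = v" "g [] = []" for g
  proof -
    have "surj g" unfolding surj_def using that(3) by (metis (no_types))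
    then show ?thesis using that(1,2,4) by (simp add: tree_auts_def bij_def inj_def)
  qed
  have "gen_c0 \<in> tree_auts" "gen_c1 \<in> tree_auts" "gen_c2 \<in> tree_auts" "gen_c3 \<in> tree_auts"
    by (rule *; simp add: gen_c_adj gen_c_inj gen_c_surj)+
  then show ?thesis
    using gen_a_tree_auts gen_alpha_tree_auts by (simp add: AutT_def)
qed

lemma subgroup_second_Basilica_GE: "subgroup second_Basilica_GE AutT"
  unfolding second_Basilica_GE_def by (rule group.generate_is_subgroup[OF group_AutT gens_in_AutT])

lemma topspace_aut_topology: "topspace aut_topology = carrier AutT"
proof -
  interpret group AutT by (rule group_AutT)
  have cosets: "g <#\<^bsub>AutT\<^esub> level_stab (carrier AutT) n \<subseteq> carrier AutT" if "g \<in> carrier AutT" for g n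
    using that by (auto simp: l_coset_def level_stab_def)
  have "g \<in> g <#\<^bsub>AutT\<^esub> level_stab (carrier AutT) 0" if "g \<in> carrier AutT" for g
  proof -
    have "\<one>\<^bsub>AutT\<^esub> \<in> level_stab (carrier AutT) 0"
      using one_closed by (simp add: level_stab_def) (simp add: AutT_def)
    then show ?thesis using that by (force simp: l_coset_def)
  qed
  note elem = this
  show ?thesis
    unfolding aut_topology_def topology_generated_by_topspace
  proof (intro equalityI subsetI)
    fix x assume "x \<in> carrier AutT"
    then show "x \<in> \<Union> {g <#\<^bsub>AutT\<^esub> level_stab (carrier AutT) n |g n. g \<in> carrier AutT}"
      by (intro UnionI[OF _ elem] CollectI exI[of _ x] exI[of _ 0] conjI refl)
  next
    fix x assume "x \<in> \<Union> {g <#\<^bsub>AutT\<^esub> level_stab (carrier AutT) n |g n. g \<in> carrier AutT}"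
    then obtain g n where "g \<in> carrier AutT" "x \<in> g <#\<^bsub>AutT\<^esub> level_stab (carrier AutT) n"
      by (elim UnionE CollectE exE conjE) simp
    then show "x \<in> carrier AutT" using cosets by (meson subsetD)
  qed
qed

end

theory Submission
  imports Defs "HOL-Real_Asymp.Real_Asymp"
begin

text \<open>
  Write \<open>B\<close> for the group and \<open>p\<^sub>k(g)\<close> for the parity of the number of vertices of depth \<open>k\<close> at
  which \<open>g\<close> interchanges the two children. Each \<open>p\<^sub>k\<close> is a homomorphism from the whole of
  \<open>Aut T\<close> to \<open>\<int>/2\<close>, and it only depends on the action on level \<open>k + 1\<close>. On the generators of \<open>B\<close>
  the value of \<open>p\<^sub>1\<close> is nontrivial at \<open>\<alpha>\<close> only, and that of \<open>p\<^sub>5\<close> at \<open>c\<^sub>0\<close> only.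

  The group is determined by a local rule (\<open>B_sections\<close>, \<open>tpair_in_B\<close>): the automorphism \<open>(x,y)\<close>
  lies in \<open>B\<close> if and only if \<open>x\<close> and \<open>y\<close> lie in \<open>B\<close> with \<open>p\<^sub>1(x) = p\<^sub>5(y)\<close> and
  \<open>p\<^sub>5(x) = p\<^sub>1(y)\<close>. The reason is that \<open>(a,1)\<close>, \<open>(c\<^sub>1,1)\<close>, \<open>(c\<^sub>2,1)\<close>, \<open>(c\<^sub>3,1)\<close> are in \<open>B\<close>,
  while \<open>c\<^sub>0\<close> and \<open>\<alpha>\<close> occur as sections of generators only together, in \<open>c\<^sub>3 = (c\<^sub>0,\<alpha>)\<close> or its conjugate
  \<open>(\<alpha>,c\<^sub>0)\<close>. So the exponents of \<open>\<alpha>\<close> and \<open>c\<^sub>0\<close> modulo 2 in one section are those of \<open>c\<^sub>0\<close> and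
  \<open>\<alpha>\<close> in the other; that nothing else is demanded comes down to \<open>(1,[c\<^sub>0,\<alpha>]) \<in> B\<close>
  (\<open>commutator_in_B\<close>).

  Let \<open>B\<^sub>n\<close> be the group that \<open>B\<close> induces on level \<open>n\<close>. As \<open>c\<^sub>0\<close> is trivial on level 5, the parity
  \<open>p\<^sub>5\<close> can be chosen freely without a change up to that level, so all pairs of sections occur and
  \<open>|B\<^sub>n\<^sub>+\<^sub>1| = 2 |B\<^sub>n|\<^sup>2\<close> for \<open>n \<le> 5\<close>. From level 6 on both parities are visible and independent, so a
  quarter of all pairs occurs: \<open>|B\<^sub>n\<^sub>+\<^sub>1| = |B\<^sub>n|\<^sup>2 / 2\<close> for \<open>n \<ge> 6\<close>. Hence
  \<open>log\<^sub>2 |B\<^sub>n| = 62 \<cdot> 2\<^sup>n\<^sup>-\<^sup>6 + 1 = (31/32) 2\<^sup>n + 1\<close> for \<open>n \<ge> 6\<close>, against \<open>2\<^sup>n - 1\<close> for \<open>Aut T\<close>.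

  The dimension follows from this count. The closure of \<open>B\<close> is covered by \<open>|B\<^sub>n|\<close> cosets of
  diameter at most \<open>2\<^sup>1\<^sup>-\<^sup>m\<close> with \<open>m = 2\<^sup>n\<close>, which bounds the dimension from above. For the lower
  bound, a cover of the compact closure may be taken to consist of finitely many cosets; a coset of level
  \<open>n\<close> contains at most the share \<open>1 / |B\<^sub>n|\<close> of the elements of \<open>B\<^sub>N\<close> for \<open>N \<ge> n\<close>, so the
  shares add up to at least 1, and \<open>1 / |B\<^sub>n|\<close> is at most the \<open>(31/32)\<close>-th power of the radius
  \<open>2\<^sup>1\<^sup>-\<^sup>m\<close> of the coset.
\<close>

section \<open>Sections of tree automorphisms\<close>

text \<open>
  The image of a child of \<open>v\<close> is a neighbour of the image of \<open>v\<close>. It cannot be the parent of that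
  image, because the parent is already the image of the parent of \<open>v\<close>.
\<close>
lemma tree_auts_snoc:
  assumes "g \<in> tree_auts"
  shows "\<exists>y. g (v @ [x]) = g v @ [y]"
proof (induction v arbitrary: x rule: rev_induct)
  case Nil
  have "g [] = []" "\<forall>u v. tree_adj (g u) (g v) \<longleftrightarrow> tree_adj u v"
    using assms unfolding tree_auts_def by blast+
  then have "tree_adj [] (g [x]) \<longleftrightarrow> tree_adj [] [x]" by metis
  then show ?case using \<open>g [] = []\<close> by (simp add: tree_adj_Nil length_Suc_conv)
next
  case (snoc z u)
  obtain y where y: "g (u @ [z]) = g u @ [y]" using snoc by blast
  have inj: "inj g" using assms bij_tree_auts bij_is_inj by blast
  have "tree_adj (g (u @ [z])) (g ((u @ [z]) @ [x]))"
    using assms unfolding tree_auts_def tree_adj_def by blast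
  moreover have "g (u @ [z]) \<noteq> g ((u @ [z]) @ [x]) @ [t]" for t
    using y inj by (auto dest: injD)
  ultimately show ?case by (auto simp: tree_adj_def)
qed

lemma tree_auts_Nil: "g \<in> tree_auts \<Longrightarrow> g [] = []"
  by (simp add: tree_auts_def)

lemma tree_auts_length:
  assumes "g \<in> tree_auts"
  shows "length (g w) = length w"
proof (induction w rule: rev_induct)
  case Nil show ?case by (simp add: tree_auts_Nil[OF assms])
next
  case (snoc x w)
  then show ?case using tree_auts_snoc[OF assms, of w x] by auto
qed

lemma tree_auts_take:
  assumes "g \<in> tree_auts"
  shows "take (length w) (g (w @ z)) = g w"
proof (induction z rule: rev_induct)
  case Nil then show ?case by (simp add: tree_auts_length[OF assms])
next
  case (snoc x z)
  obtain y where "g ((w @ z) @ [x]) = g (w @ z) @ [y]" using tree_auts_snoc[OF assms] by blast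
  then show ?case using snoc by (simp add: tree_auts_length[OF assms])
qed

lemma tree_auts_inj: "g \<in> tree_auts \<Longrightarrow> g u = g v \<longleftrightarrow> u = v"
  by (simp add: bij_tree_auts bij_is_inj inj_eq)

lemma tree_auts_adj: "g \<in> tree_auts \<Longrightarrow> tree_adj (g u) (g v) \<longleftrightarrow> tree_adj u v"
  by (simp add: tree_auts_def)

text \<open>
  The action on the first level, as an element of \<open>\<int>/2\<close>: with letters and swaps both read as
  booleans, the letter \<open>x\<close> is sent to \<open>x \<noteq> swaps g\<close>, inequality being addition modulo 2.
\<close>
definition swaps :: "(word \<Rightarrow> word) \<Rightarrow> bool" where
  "swaps g \<longleftrightarrow> g [False] = [True]"

definition sec :: "(word \<Rightarrow> word) \<Rightarrow> bool \<Rightarrow> word \<Rightarrow> word" where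
  "sec g x w = tl (g (x # w))"

lemma tree_auts_Cons:
  assumes g: "g \<in> tree_auts"
  shows "g (x # w) = (x \<noteq> swaps g) # sec g x w"
proof -
  have "length (g [x]) = 1" "length (g [\<not> x]) = 1" by (simp_all add: tree_auts_length[OF g])
  then obtain y z where yz: "g [x] = [y]" "g [\<not> x] = [z]"
    by (auto simp: length_Suc_conv)
  then have "y \<noteq> z" using tree_auts_inj[OF g, of "[x]" "[\<not> x]"] by auto
  then have y: "y = (x \<noteq> swaps g)" using yz by (cases x) (auto simp: swaps_def)
  have "take 1 (g ([x] @ w)) = [y]" using tree_auts_take[OF g, of "[x]" w] yz by simp
  moreover have "length (g ([x] @ w)) = Suc (length w)" by (simp add: tree_auts_length[OF g])
  ultimately show ?thesis using y by (cases "g (x # w)") (auto simp: sec_def)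
qed

lemma sec_tree_auts [simp]:
  assumes g: "g \<in> tree_auts"
  shows "sec g x \<in> tree_auts"
proof -
  have inj: "sec g x u = sec g x v \<longleftrightarrow> u = v" for u v
    using tree_auts_inj[OF g, of "x # u" "x # v"] by (simp add: tree_auts_Cons[OF g])
  have "\<exists>u. sec g x u = v" for v
  proof -
    obtain u where u: "g u = (x \<noteq> swaps g) # v"
      using bij_tree_auts[OF g] by (metis bij_pointE)
    show ?thesis
    proof (cases u)
      case Nil then show ?thesis using u by (simp add: tree_auts_Nil[OF g])
    next
      case (Cons y w)
      then show ?thesis using u by (auto simp: tree_auts_Cons[OF g])
    qed
  qed
  then have "surj (sec g x)" unfolding surj_def by metis
  moreover have "tree_adj (sec g x u) (sec g x v) \<longleftrightarrow> tree_adj u v" for u v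
    using tree_auts_adj[OF g, of "x # u" "x # v"] by (simp add: tree_auts_Cons[OF g] tree_adj_Cons)
  moreover have "sec g x [] = []"
    using tree_auts_length[OF g, of "[x]"] by (simp add: tree_auts_Cons[OF g])
  ultimately show ?thesis using inj by (simp add: tree_auts_def bij_def inj_def)
qed

lemma comp_tree_auts [simp]: "g \<in> tree_auts \<Longrightarrow> h \<in> tree_auts \<Longrightarrow> g \<circ> h \<in> tree_auts"
  using monoid.m_closed[OF group.is_monoid[OF group_AutT]] by (simp add: AutT_def)

lemma swaps_comp:
  "g \<in> tree_auts \<Longrightarrow> h \<in> tree_auts \<Longrightarrow> swaps (g \<circ> h) = (swaps g \<noteq> swaps h)"
  by (auto simp: swaps_def[of "g \<circ> h"] tree_auts_Cons[of g] tree_auts_Cons[of h]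
      tree_auts_Nil[of "sec g x" for x] tree_auts_Nil[of "sec h x" for x])

lemma sec_comp:
  "g \<in> tree_auts \<Longrightarrow> h \<in> tree_auts \<Longrightarrow> sec (g \<circ> h) x = sec g (x \<noteq> swaps h) \<circ> sec h x"
  by (rule ext) (simp add: sec_def[of "g \<circ> h"] tree_auts_Cons[of g] tree_auts_Cons[of h])

lemma tree_auts_eqI:
  assumes "g \<in> tree_auts" "h \<in> tree_auts" "swaps g = swaps h" "\<And>x. sec g x = sec h x"
  shows "g = h"
proof
  fix w show "g w = h w" using assms by (cases w)
      (simp_all add: tree_auts_Cons[of g] tree_auts_Cons[of h] tree_auts_Nil[of g] tree_auts_Nil[of h])
qed

lemma tpair_in_tree_auts [simp]:
  "x \<in> tree_auts \<Longrightarrow> y \<in> tree_auts \<Longrightarrow> tpair x y \<in> tree_auts"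
  by (rule tpair_tree_auts) (simp_all add: tree_auts_length[of x] tree_auts_length[of y])

lemma gens_tree_auts [simp]:
  "gen_a \<in> tree_auts" "gen_alpha \<in> tree_auts" "gen_c0 \<in> tree_auts" "gen_c1 \<in> tree_auts"
  "gen_c2 \<in> tree_auts" "gen_c3 \<in> tree_auts" "id \<in> tree_auts"
  using gens_in_AutT id_tree_auts by (auto simp: AutT_def)

lemma swaps_tpair [simp]: "swaps (tpair x y) = False"
  by (simp add: swaps_def)

lemma sec_tpair [simp]: "sec (tpair x y) False = x" "sec (tpair x y) True = y"
  by (auto simp: sec_def)

lemma swaps_a [simp]: "swaps gen_a = True"
  by (simp add: swaps_def)

lemma sec_a [simp]: "sec gen_a x = id"
  by (auto simp: sec_def)

lemma swaps_id [simp]: "swaps id = False"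
  by (simp add: swaps_def)

lemma sec_id [simp]: "sec id x = id"
  by (auto simp: sec_def)

lemma tpair_id [simp]: "tpair id id = id"
  by (rule tree_auts_eqI) (simp_all, metis (full_types) sec_tpair)

lemma tpair_comp:
  "tpair x y \<circ> tpair x' y' = tpair (x \<circ> x') (y \<circ> y')"
proof
  fix w show "(tpair x y \<circ> tpair x' y') w = tpair (x \<circ> x') (y \<circ> y') w"
    by (cases "(x, y, w)" rule: tpair.cases) auto
qed

lemma a_tpair_a: "gen_a \<circ> tpair x y \<circ> gen_a = tpair y x"
proof
  fix w show "(gen_a \<circ> tpair x y \<circ> gen_a) w = tpair y x w"
    by (cases "(x, y, w)" rule: tpair.cases) auto
qed

lemma tpair_sec: "g \<in> tree_auts \<Longrightarrow> \<not> swaps g \<Longrightarrow> tpair (sec g False) (sec g True) = g"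
  by (rule tree_auts_eqI) (simp_all, metis (full_types) sec_tpair)

lemma a_a [simp]: "gen_a \<circ> gen_a = id"
proof
  fix w show "(gen_a \<circ> gen_a) w = id w" by (cases w) auto
qed

section \<open>Parities on the levels of the tree\<close>

text \<open>
  The parity \<open>p\<^sub>k(g)\<close> of the number of vertices of depth \<open>k\<close> at which \<open>g\<close> interchanges the children,
  that is, of the nontrivial labels of the portrait of \<open>g\<close> at depth \<open>k\<close>.
\<close>
primrec parity :: "nat \<Rightarrow> (word \<Rightarrow> word) \<Rightarrow> bool" where
  "parity 0 g = swaps g"
| "parity (Suc k) g = (parity k (sec g False) \<noteq> parity k (sec g True))"

text \<open>
  A factor that interchanges the two subtrees only permutes the labels at depth \<open>k\<close> of the other factor, which
  leaves their sum unchanged.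
\<close>
lemma parity_comp:
  "g \<in> tree_auts \<Longrightarrow> h \<in> tree_auts \<Longrightarrow> parity k (g \<circ> h) = (parity k g \<noteq> parity k h)"
proof (induction k arbitrary: g h)
  case (Suc k)
  show ?case
    by (cases "swaps h") (auto simp: sec_comp[OF Suc.prems] Suc.IH[OF sec_tree_auts sec_tree_auts, OF Suc.prems]
        simp del: comp_apply)
qed (simp add: swaps_comp)

lemma parity_id [simp]: "parity k (id :: word \<Rightarrow> word) = False"
  by (induction k) (simp_all del: id_apply)

definition agree :: "nat \<Rightarrow> (word \<Rightarrow> word) \<Rightarrow> (word \<Rightarrow> word) \<Rightarrow> bool" where
  "agree n g h \<longleftrightarrow> (\<forall>w. length w = n \<longrightarrow> g w = h w)"

lemma agree_refl [simp]: "agree n g g"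
  and agree_sym: "agree n g h \<Longrightarrow> agree n h g"
  and agree_trans: "agree n g h \<Longrightarrow> agree n h k \<Longrightarrow> agree n g k"
  by (auto simp: agree_def)

lemma agree_le:
  assumes "g \<in> tree_auts" "h \<in> tree_auts" "agree n g h" "m \<le> n"
  shows "agree m g h"
  unfolding agree_def
proof (intro allI impI)
  fix w :: word assume w: "length w = m"
  define z where "z = replicate (n - m) False"
  have "g (w @ z) = h (w @ z)" using assms w by (auto simp: agree_def z_def)
  then show "g w = h w" using tree_auts_take assms(1,2) by metis
qed

lemma agree_0 [simp]: "g \<in> tree_auts \<Longrightarrow> h \<in> tree_auts \<Longrightarrow> agree 0 g h"
  by (simp add: agree_def tree_auts_Nil[of g] tree_auts_Nil[of h])

text \<open>
  Passing from level \<open>n\<close> to level \<open>n + 1\<close> is passing to the sections; all counting below is by this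
  recursion.
\<close>
lemma agree_Suc:
  assumes "g \<in> tree_auts" "h \<in> tree_auts"
  shows "agree (Suc n) g h \<longleftrightarrow> swaps g = swaps h \<and> (\<forall>x. agree n (sec g x) (sec h x))"
proof
  assume L: "agree (Suc n) g h"
  have "agree 1 g h" using agree_le[OF assms L] by simp
  then have "swaps g = swaps h" by (auto simp: agree_def swaps_def)
  moreover have "sec g x w = sec h x w" if "length w = n" for x w
    using L that by (auto simp: agree_def sec_def)
  ultimately show "swaps g = swaps h \<and> (\<forall>x. agree n (sec g x) (sec h x))" by (auto simp: agree_def)
next
  assume R: "swaps g = swaps h \<and> (\<forall>x. agree n (sec g x) (sec h x))"
  show "agree (Suc n) g h"
    unfolding agree_def
  proof (intro allI impI)
    fix w :: word assume "length w = Suc n"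
    then obtain x u where "w = x # u" "length u = n" by (auto simp: length_Suc_conv)
    then show "g w = h w" using R assms
      by (simp add: tree_auts_Cons[of g] tree_auts_Cons[of h] agree_def)
  qed
qed

lemma parity_agree:
  "g \<in> tree_auts \<Longrightarrow> h \<in> tree_auts \<Longrightarrow> agree (Suc k) g h \<Longrightarrow> parity k g = parity k h"
proof (induction k arbitrary: g h)
  case 0 then show ?case using agree_Suc by simp
next
  case (Suc k)
  have "parity k (sec g x) = parity k (sec h x)" for x
    using Suc agree_Suc[of g h "Suc k"] by simp
  then show ?case by simp
qed

section \<open>Which pairs of sections occur in the second Basilica group\<close>

abbreviation B where "B \<equiv> second_Basilica_GE"

lemma B_tree_auts: "b \<in> B \<Longrightarrow> b \<in> tree_auts"
  using subgroup.subset[OF subgroup_second_Basilica_GE] by (auto simp: AutT_def)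

lemma B_id [simp]: "id \<in> B"
  using subgroup.one_closed[OF subgroup_second_Basilica_GE] by (simp add: AutT_def)

lemma B_comp [simp]: "g \<in> B \<Longrightarrow> h \<in> B \<Longrightarrow> g \<circ> h \<in> B"
  using subgroup.m_closed[OF subgroup_second_Basilica_GE] by (simp add: AutT_def)

lemma AutT_simps [simp]: "carrier AutT = tree_auts" "x \<otimes>\<^bsub>AutT\<^esub> y = x \<circ> y" "\<one>\<^bsub>AutT\<^esub> = id"
  by (simp_all add: AutT_def)

lemma AutT_inv:
  assumes "g \<in> tree_auts"
  shows "inv\<^bsub>AutT\<^esub> g \<in> tree_auts" "inv\<^bsub>AutT\<^esub> g \<circ> g = id" "g \<circ> inv\<^bsub>AutT\<^esub> g = id"
  using group.inv_closed[OF group_AutT] group.l_inv[OF group_AutT] group.r_inv[OF group_AutT] assms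
  by auto

lemma B_inverse:
  assumes "b \<in> B" obtains b' where "b' \<in> B" "b' \<circ> b = id" "b \<circ> b' = id"
  using subgroup.m_inv_closed[OF subgroup_second_Basilica_GE assms] AutT_inv[OF B_tree_auts[OF assms]]
  by blast

lemma gens_B [simp]:
  "gen_a \<in> B" "gen_alpha \<in> B" "gen_c0 \<in> B" "gen_c1 \<in> B" "gen_c2 \<in> B" "gen_c3 \<in> B"
  by (auto simp: second_Basilica_GE_def intro: generate.incl)

lemma alpha_alpha [simp]: "gen_alpha \<circ> gen_alpha = id"
  by (simp add: gen_alpha_def tpair_comp)

lemma c_c [simp]:
  "gen_c0 \<circ> gen_c0 = id" "gen_c1 \<circ> gen_c1 = id" "gen_c2 \<circ> gen_c2 = id" "gen_c3 \<circ> gen_c3 = id"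
proof -
  have alpha: "gen_alpha (gen_alpha w) = w" for w
    using alpha_alpha by (metis comp_apply id_apply)
  have "gen_c0 (gen_c0 w) = w \<and> gen_c1 (gen_c1 w) = w \<and> gen_c2 (gen_c2 w) = w \<and> gen_c3 (gen_c3 w) = w" for w
  proof (induction w)
    case (Cons x w) then show ?case by (cases x) (auto simp: alpha)
  qed simp
  then show "gen_c0 \<circ> gen_c0 = id" "gen_c1 \<circ> gen_c1 = id" "gen_c2 \<circ> gen_c2 = id" "gen_c3 \<circ> gen_c3 = id"
    by auto
qed

text \<open>
  The generators are involutions, so every element of the group is a product of generators and
  inverses need no case of their own.
\<close>
lemma B_induct [consumes 1, case_names id comp]:
  fixes P :: "(word \<Rightarrow> word) \<Rightarrow> bool"
  assumes b: "b \<in> B" and id: "P (id :: word \<Rightarrow> word)"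
    and step: "\<And>g b. g \<in> {gen_a, gen_alpha, gen_c0, gen_c1, gen_c2, gen_c3} \<Longrightarrow> b \<in> B \<Longrightarrow> P b \<Longrightarrow> P (g \<circ> b)"
  shows "P b"
proof -
  have "\<forall>b'\<in>B. P b' \<longrightarrow> P (b \<circ> b')"
    using b unfolding second_Basilica_GE_def
  proof (induction rule: generate.induct)
    case one then show ?case by simp
  next
    case (incl h)
    then show ?case by (intro ballI impI step) (simp_all only: second_Basilica_GE_def)
  next
    case (inv h)
    have "h \<circ> h = id" using inv by auto
    moreover have "h \<in> tree_auts" using inv by auto
    ultimately have "inv\<^bsub>AutT\<^esub> h = h"
      using group.inv_equality[OF group_AutT, of h h] by simp
    then show ?case using inv by (intro ballI impI) (simp only: step second_Basilica_GE_def)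
  next
    case (eng h1 h2)
    have "P (h1 \<circ> h2 \<circ> b')" if "b' \<in> B" "P b'" for b'
      using eng that by (simp add: comp_assoc flip: second_Basilica_GE_def del: comp_apply)
    then show ?case by (simp add: second_Basilica_GE_def del: comp_apply)
  qed
  then show ?thesis using id by auto
qed

text \<open>
  The parities \<open>p\<^sub>1\<close> and \<open>p\<^sub>5\<close> count the occurrences of \<open>\<alpha>\<close> and of \<open>c\<^sub>0\<close> modulo 2: the only
  nontrivial label of \<open>\<alpha>\<close> is at depth 1, while those of \<open>c\<^sub>0, c\<^sub>1, c\<^sub>2, c\<^sub>3\<close> are at the depths
  congruent to \<open>1, 0, 3, 2\<close> modulo 4, starting with \<open>5, 4, 3, 2\<close>.
\<close>
lemma parity_gens [simp]:
  "parity 1 gen_a = False" "parity 1 gen_alpha = True" "parity 1 gen_c0 = False"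
  "parity 1 gen_c1 = False" "parity 1 gen_c2 = False" "parity 1 gen_c3 = False"
  "parity 5 gen_a = False" "parity 5 gen_alpha = False" "parity 5 gen_c0 = True"
  "parity 5 gen_c1 = False" "parity 5 gen_c2 = False" "parity 5 gen_c3 = False"
proof -
  have a: "parity 0 gen_a" "\<And>k. \<not> parity (Suc k) gen_a" by auto
  have al: "parity (Suc k) gen_alpha = parity k gen_a" "\<not> parity 0 gen_alpha" for k
    unfolding gen_alpha_def by auto
  have c: "parity (Suc k) gen_c0 = parity k gen_c1" "parity (Suc k) gen_c1 = parity k gen_c2"
    "parity (Suc k) gen_c2 = parity k gen_c3" "parity (Suc k) gen_c3 = (parity k gen_c0 \<noteq> parity k gen_alpha)" for k
    by (subst gen_c0_eq gen_c1_eq gen_c2_eq gen_c3_eq, simp)+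
  have c': "\<not> parity 0 gen_c0" "\<not> parity 0 gen_c1" "\<not> parity 0 gen_c2" "\<not> parity 0 gen_c3"
    by (simp_all add: swaps_def)
  have n: "(1::nat) = Suc 0" "5 = Suc (Suc (Suc (Suc (Suc 0))))" by simp_all
  show "parity 1 gen_a = False" "parity 1 gen_alpha = True" "parity 1 gen_c0 = False"
    "parity 1 gen_c1 = False" "parity 1 gen_c2 = False" "parity 1 gen_c3 = False"
    "parity 5 gen_a = False" "parity 5 gen_alpha = False" "parity 5 gen_c0 = True"
    "parity 5 gen_c1 = False" "parity 5 gen_c2 = False" "parity 5 gen_c3 = False"
    unfolding n using a al c c' by (simp_all del: parity.simps)
qed

text \<open>
  One half of the local rule that describes the group. It holds for the generators and is inherited
  by products since the parities are homomorphisms.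
\<close>
lemma B_sections:
  assumes "b \<in> B"
  shows "sec b x \<in> B \<and> parity 1 (sec b x) = parity 5 (sec b (\<not> x))"
  using assms
proof (induction arbitrary: x rule: B_induct)
  case id
  show ?case by (simp del: id_apply)
next
  case (comp g b)
  have g: "g \<in> B" using comp(1) by auto
  have gs: "sec g y \<in> B \<and> parity 1 (sec g y) = parity 5 (sec g (\<not> y))" for y
  proof -
    have s: "sec gen_alpha y = (if y then id else gen_a)" "sec gen_c0 y = (if y then id else gen_c1)"
      "sec gen_c1 y = (if y then id else gen_c2)" "sec gen_c2 y = (if y then id else gen_c3)"
      "sec gen_c3 y = (if y then gen_alpha else gen_c0)" for y
      using sec_tpair[of gen_a id] sec_tpair[of gen_c1 id] sec_tpair[of gen_c2 id]
        sec_tpair[of gen_c3 id] sec_tpair[of gen_c0 gen_alpha]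
      by (cases y; simp only: gen_alpha_def[symmetric] gen_c0_eq[symmetric] gen_c1_eq[symmetric]
          gen_c2_eq[symmetric] gen_c3_eq[symmetric] if_True if_False)+
    show ?thesis using comp(1) by (cases y) (auto simp: s simp del: One_nat_def parity.simps)
  qed
  show ?case
    using comp(3) gs g comp(2) by (auto simp: sec_comp parity_comp B_tree_auts simp del: One_nat_def parity.simps comp_apply)
qed

text \<open>
  An element that is admissible as a section at 1 beside a section at 0 with parities
  \<open>p\<^sub>1 = i\<close> and \<open>p\<^sub>5 = j\<close>.
\<close>
definition partner :: "bool \<Rightarrow> bool \<Rightarrow> word \<Rightarrow> word" where
  "partner i j = (if i then gen_c0 else id) \<circ> (if j then gen_alpha else id)"

lemma partner_B [simp]: "partner i j \<in> B"
  by (simp add: partner_def)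

lemma parity_partner: "parity 1 (partner i j) = j" "parity 5 (partner i j) = i"
  by (simp_all add: partner_def parity_comp del: One_nat_def parity.simps)

lemma tpair_alpha_c0_in_B: "tpair gen_alpha gen_c0 \<in> B"
  using B_comp[OF B_comp[OF gens_B(1) gens_B(6)] gens_B(1)] by (simp add: gen_c3_eq a_tpair_a)

text \<open>
  The point is that \<open>[a,\<alpha>] = (a,a)\<close> and that \<open>[(a,a),c\<^sub>0] = ([a,c\<^sub>1],1)\<close> agrees with
  \<open>[\<alpha>,c\<^sub>0] = ([a,c\<^sub>1],1)\<close>. Now \<open>(a,1)\<close> is in \<open>B\<close>, and the elements \<open>x\<close> with \<open>(x,1) \<in> B\<close> are closed
  under taking commutators with \<open>c\<^sub>0\<close> and \<open>\<alpha>\<close>, since \<open>(c\<^sub>0,\<alpha>)\<close> and \<open>(\<alpha>,c\<^sub>0)\<close> are in \<open>B\<close>.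
  Conjugation by \<open>a\<close> moves the result to the other section.
\<close>
lemma commutator_in_B: "tpair id (gen_c0 \<circ> gen_alpha \<circ> gen_c0 \<circ> gen_alpha) \<in> B"
proof -
  let ?k = "gen_c0 \<circ> gen_alpha \<circ> gen_c0 \<circ> gen_alpha"
  have alpha: "tpair gen_a id \<in> B" using gens_B(2) by (simp add: gen_alpha_def)
  have c3: "tpair gen_c0 gen_alpha \<in> B" using gens_B(6) by (simp add: gen_c3_eq)
  let ?u = "gen_a \<circ> gen_alpha \<circ> gen_a \<circ> gen_alpha"
  have u: "tpair gen_a id \<circ> tpair gen_alpha gen_c0 \<circ> tpair gen_a id \<circ> tpair gen_alpha gen_c0
      = tpair ?u id" by (simp add: tpair_comp)
  have uB: "tpair ?u id \<in> B"
    using B_comp[OF B_comp[OF B_comp[OF alpha tpair_alpha_c0_in_B] alpha] tpair_alpha_c0_in_B]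
    by (simp only: u)
  have ue: "?u = tpair gen_a gen_a"
    using a_tpair_a[of gen_a id] by (simp add: gen_alpha_def tpair_comp comp_assoc)
  \<comment> \<open>The commutator of \<open>(c\<^sub>0,\<alpha>)\<close> with \<open>([a,\<alpha>],1)\<close>: the two factors \<open>\<alpha>\<close> at 1 cancel.\<close>
  have "tpair gen_c0 gen_alpha \<circ> tpair (tpair gen_a gen_a) id \<circ> tpair gen_c0 gen_alpha
     \<circ> tpair (tpair gen_a gen_a) id \<in> B"
    using uB ue c3 by simp
  moreover have "gen_c0 \<circ> tpair gen_a gen_a \<circ> gen_c0 \<circ> tpair gen_a gen_a = ?k"
    by (simp add: gen_alpha_def gen_c0_eq tpair_comp)
  ultimately have "tpair ?k id \<in> B" by (simp add: tpair_comp)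
  then show ?thesis
    using B_comp[OF B_comp[OF gens_B(1)] gens_B(1), of "tpair ?k id"] by (simp only: a_tpair_a)
qed

text \<open>
  Multiplying \<open>b\<close> by a generator multiplies its partner by \<open>\<alpha>\<close>, \<open>c\<^sub>0\<close> or 1, and brings it back to the
  normal form \<open>c\<^sub>0\<^sup>i \<alpha>\<^sup>j\<close> up to the commutator of \<open>c\<^sub>0\<close> and \<open>\<alpha>\<close>.
\<close>
lemma tpair_partner_in_B:
  assumes "b \<in> B"
  shows "tpair b (partner (parity 1 b) (parity 5 b)) \<in> B"
  using assms
proof (induction rule: B_induct)
  case id
  show ?case by (simp add: partner_def del: id_apply)
next
  case (comp g b)
  let ?i = "parity 1 b" and ?j = "parity 5 b"
  have bt: "b \<in> tree_auts" using comp B_tree_auts by blast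
  have lift: "tpair (g \<circ> b) (t \<circ> partner ?i ?j) \<in> B" if "tpair g t \<in> B" for t
    using B_comp[OF that comp(3)] by (simp add: tpair_comp)
  have gB: "tpair gen_a id \<in> B" "tpair gen_c1 id \<in> B" "tpair gen_c2 id \<in> B" "tpair gen_c3 id \<in> B"
    "tpair gen_c0 gen_alpha \<in> B"
    using gens_B by (simp_all only: gen_alpha_def[symmetric] gen_c0_eq[symmetric]
        gen_c1_eq[symmetric] gen_c2_eq[symmetric] gen_c3_eq[symmetric])
  have cancel: "gen_alpha \<circ> (gen_alpha \<circ> f) = f" "gen_c0 \<circ> (gen_c0 \<circ> f) = f" for f :: "word \<Rightarrow> word"
    by (simp_all flip: comp_assoc)
  consider "g = gen_c0" | "g = gen_alpha" | "g \<in> {gen_a, gen_c1, gen_c2, gen_c3}"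
    using comp(1) by auto
  then show ?case
  proof cases
    case 1
    have "tpair (gen_c0 \<circ> b) (partner ?i (\<not> ?j)) \<in> B"
    proof (cases ?i)
      case True
      let ?k = "gen_c0 \<circ> gen_alpha \<circ> gen_c0 \<circ> gen_alpha"
      have "?k \<circ> (gen_alpha \<circ> partner ?i ?j) = partner ?i (\<not> ?j)"
        using True cancel by (simp add: partner_def comp_assoc)
      moreover have "tpair id ?k \<circ> tpair (g \<circ> b) (gen_alpha \<circ> partner ?i ?j) \<in> B"
        using commutator_in_B lift[of gen_alpha] gB(5) 1 by (intro B_comp) simp_all
      ultimately show ?thesis using 1 by (simp add: tpair_comp)
    next
      case False
      then have "gen_alpha \<circ> partner ?i ?j = partner ?i (\<not> ?j)" by (simp add: partner_def)
      then show ?thesis using lift[of gen_alpha] gB(5) 1 by simp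
    qed
    then show ?thesis using 1 bt by (simp add: parity_comp del: One_nat_def parity.simps comp_apply)
  next
    case 2
    have "gen_c0 \<circ> partner ?i ?j = partner (\<not> ?i) ?j"
      by (simp add: partner_def flip: comp_assoc)
    then show ?thesis using lift[of gen_c0] tpair_alpha_c0_in_B 2 bt by (simp add: parity_comp del: One_nat_def parity.simps comp_apply)
  next
    case 3
    then have "tpair g id \<in> B" "\<not> parity 1 g" "\<not> parity 5 g" "g \<in> tree_auts" using gB by (auto simp del: One_nat_def parity.simps)
    then show ?thesis using lift[of id] bt by (simp add: parity_comp del: One_nat_def parity.simps comp_apply)
  qed
qed

text \<open>
  The other half of the local rule. Let \<open>x'\<close> and \<open>y'\<close> be the partners of \<open>x = b0\<close> and \<open>y = b1\<close>.
  By the hypotheses on the parities \<open>x'\<close> is the partner of \<open>y'\<close> too, and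
  \<open>(x,y) = (x,x') (y',x')\<^sup>-\<^sup>1 (y',y)\<close> is a product of elements of \<open>B\<close>.
\<close>
lemma tpair_in_B:
  assumes b: "b0 \<in> B" "b1 \<in> B" and p: "parity 1 b0 = parity 5 b1" "parity 5 b0 = parity 1 b1"
  shows "tpair b0 b1 \<in> B"
proof -
  let ?i = "parity 1 b0" and ?j = "parity 5 b0"
  let ?t = "tpair (partner ?j ?i) (partner ?i ?j)"
  have 1: "tpair b0 (partner ?i ?j) \<in> B" using tpair_partner_in_B b by blast
  have "tpair b1 (partner ?j ?i) \<in> B" using tpair_partner_in_B[OF b(2)] p by simp
  then have 2: "tpair (partner ?j ?i) b1 \<in> B"
    using B_comp[OF B_comp[OF gens_B(1)] gens_B(1), of "tpair b1 (partner ?j ?i)"]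
    by (simp only: a_tpair_a)
  have "?t \<in> B"
    using tpair_partner_in_B[OF partner_B, of ?j ?i] by (simp only: parity_partner)
  then obtain t' where t': "t' \<in> B" "t' \<circ> ?t = id" "?t \<circ> t' = id" by (rule B_inverse)
  have tt: "t' \<in> tree_auts" using t' B_tree_auts by blast
  have "swaps t' = False" using t'(3) tt swaps_comp[of ?t t'] B_tree_auts[OF \<open>?t \<in> B\<close>] by simp
  then obtain x y where xy: "t' = tpair x y" using tpair_sec[OF tt] by metis
  have "tpair (x \<circ> partner ?j ?i) (y \<circ> partner ?i ?j) = id"
       "tpair (partner ?j ?i \<circ> x) (partner ?i ?j \<circ> y) = id"
    using t'(2,3) xy by (simp_all add: tpair_comp)
  then have "x \<circ> partner ?j ?i = id" "partner ?i ?j \<circ> y = id"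
    using sec_tpair sec_id by metis+
  then have "tpair b0 (partner ?i ?j) \<circ> t' \<circ> tpair (partner ?j ?i) b1 = tpair b0 b1"
    by (simp add: xy tpair_comp comp_assoc)
  then show ?thesis using 1 2 B_comp[OF B_comp[OF 1 t'(1)] 2] by simp
qed

section \<open>Orders of the congruence quotients\<close>

text \<open>
  The action on level \<open>n\<close> only: \<open>trunc n ` G\<close> stands for the quotient of a group \<open>G\<close> by its level
  stabiliser.
\<close>
definition trunc :: "nat \<Rightarrow> (word \<Rightarrow> word) \<Rightarrow> word \<Rightarrow> word" where
  "trunc n g = restrict g {w. length w = n}"

lemma trunc_eq_iff: "trunc n g = trunc n h \<longleftrightarrow> agree n g h"
proof
  assume "trunc n g = trunc n h"
  then have "trunc n g w = trunc n h w" for w by simp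
  from this[unfolded trunc_def restrict_def] show "agree n g h"
    by (simp add: agree_def) metis
qed (auto simp: trunc_def agree_def restrict_def)

lemma card_image_cong_kernel:
  assumes "\<And>x y. x \<in> A \<Longrightarrow> y \<in> A \<Longrightarrow> f x = f y \<longleftrightarrow> h x = h y"
  shows "card (f ` A) = card (h ` A)"
proof -
  have inj: "inj_on (\<lambda>y. h (inv_into A f y)) (f ` A)"
    using assms by (auto simp: inj_on_def f_inv_into_f inv_into_into) (metis f_inv_into_f imageI inv_into_into)+
  have "h (inv_into A f (f x)) = h x" if "x \<in> A" for x
    using assms that by (metis f_inv_into_f imageI inv_into_into)
  then have "(\<lambda>y. h (inv_into A f y)) ` (f ` A) = h ` A"
    by (auto simp: image_iff)
  then show ?thesis using card_image[OF inj] by simp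
qed

lemma finite_trunc: "finite (trunc n ` G)" if "G \<subseteq> tree_auts"
proof -
  have "finite {w :: word. length w = n}" using finite_lists_length_eq[of "UNIV :: bool set" n] by simp
  then have "finite ({w :: word. length w = n} \<rightarrow>\<^sub>E {w :: word. length w = n})"
    by (intro finite_PiE) auto
  moreover have "trunc n g \<in> {w. length w = n} \<rightarrow>\<^sub>E {w. length w = n}" if "g \<in> tree_auts" for g
    by (auto simp: trunc_def PiE_def extensional_def restrict_def tree_auts_length[OF that])
  ultimately show ?thesis using that by (meson finite_subset image_subsetI subsetD)
qed

lemma card_trunc_Suc:
  assumes "G \<subseteq> tree_auts"
  shows "card (trunc (Suc n) ` G)
    = card ((\<lambda>g. (swaps g, trunc n (sec g False), trunc n (sec g True))) ` G)"
proof (rule card_image_cong_kernel)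
  fix g h assume "g \<in> G" "h \<in> G"
  then have "g \<in> tree_auts" "h \<in> tree_auts" using assms by auto
  then show "trunc (Suc n) g = trunc (Suc n) h \<longleftrightarrow>
    (swaps g, trunc n (sec g False), trunc n (sec g True)) = (swaps h, trunc n (sec h False), trunc n (sec h True))"
    by (simp add: trunc_eq_iff agree_Suc) (metis (full_types))
qed

lemma card_trunc_0: "G \<subseteq> tree_auts \<Longrightarrow> G \<noteq> {} \<Longrightarrow> card (trunc 0 ` G) = 1"
proof -
  assume G: "G \<subseteq> tree_auts" "G \<noteq> {}"
  then obtain g where g: "g \<in> G" by auto
  have "trunc 0 h = trunc 0 g" if "h \<in> G" for h
  proof -
    have "h \<in> tree_auts" "g \<in> tree_auts" using that g G by blast+
    then show ?thesis by (simp add: trunc_eq_iff)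
  qed
  then have "trunc 0 ` G = {trunc 0 g}" using g by blast
  then show ?thesis by simp
qed

text \<open>
  The order of a group that is the full wreath product of the previous one by \<open>\<int>/2\<close> on each level.
\<close>
lemma card_full_recursion:
  fixes N :: "nat \<Rightarrow> nat"
  assumes "N 0 = 1" and "\<And>n. n < m \<Longrightarrow> N (Suc n) = 2 * (N n)\<^sup>2"
  shows "n \<le> m \<Longrightarrow> N n = 2 ^ (2 ^ n - 1)"
proof (induction n)
  case (Suc n)
  have "Suc (2 * (2 ^ n - 1)) = 2 ^ Suc n - (1::nat)"
    using not0_implies_Suc[of "2 ^ n :: nat"] by auto
  moreover have "N (Suc n) = 2 ^ Suc (2 * (2 ^ n - 1))"
    using assms(2)[of n] Suc by (simp add: power_mult power2_eq_square power_mult_distrib flip: power_add mult_2)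
  ultimately show ?case by simp
qed (use assms in simp)

lemma assemble_sections:
  assumes "x \<in> tree_auts" "y \<in> tree_auts"
  defines "g \<equiv> \<lambda>s. if s then gen_a \<circ> tpair x y else tpair x y"
  shows "g s \<in> tree_auts" "swaps (g s) = s" "sec (g s) False = x" "sec (g s) True = y"
  using assms by (cases s; simp add: g_def swaps_comp sec_comp)+

lemma card_trunc_AutT: "card (trunc n ` tree_auts) = 2 ^ (2 ^ n - 1)"
proof (rule card_full_recursion[where m = n and N = "\<lambda>n. card (trunc n ` tree_auts)"])
  show "card (trunc 0 ` tree_auts) = 1" by (rule card_trunc_0) (auto intro: id_tree_auts)
next
  fix n
  have "(\<lambda>g. (swaps g, trunc n (sec g False), trunc n (sec g True))) ` tree_auts
      = UNIV \<times> trunc n ` tree_auts \<times> trunc n ` tree_auts" (is "?f ` _ = _")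
  proof (intro equalityI subsetI)
    fix z :: "bool \<times> (word \<Rightarrow> word) \<times> (word \<Rightarrow> word)"
    assume "z \<in> UNIV \<times> trunc n ` tree_auts \<times> trunc n ` tree_auts"
    then obtain s x y where xy: "x \<in> tree_auts" "y \<in> tree_auts" "z = (s, trunc n x, trunc n y)" by auto
    show "z \<in> ?f ` tree_auts"
      by (rule image_eqI[OF _ assemble_sections(1)[OF xy(1,2), of s]])
        (simp only: assemble_sections(2-4)[OF xy(1,2)] xy(3))
  qed auto
  then show "card (trunc (Suc n) ` tree_auts) = 2 * (card (trunc n ` tree_auts))\<^sup>2"
    by (simp add: card_trunc_Suc card_cartesian_product power2_eq_square)
qed simp

lemma c0_agree_id: "agree 5 gen_c0 id"
  unfolding agree_def
proof (intro allI impI)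
  fix w :: word assume "length w = 5"
  then obtain a b c d e where "w = [a, b, c, d, e]"
    by (auto simp: length_Suc_conv numeral_eq_Suc)
  then show "gen_c0 w = id w"
    by (cases a; cases b; cases c; cases d; cases e) (simp_all add: gen_alpha_def)
qed

lemma B_assemble_sections:
  assumes "x \<in> B" "y \<in> B" "parity 1 x = parity 5 y" "parity 5 x = parity 1 y"
  shows "(if s then gen_a \<circ> tpair x y else tpair x y) \<in> B"
  using tpair_in_B[OF assms] by simp

text \<open>
  Up to level 5 the parity \<open>p\<^sub>5\<close> of a section can be corrected by \<open>c\<^sub>0\<close>, which acts trivially there.
  So the local rule imposes nothing on the action of the sections on these levels.
\<close>
lemma card_trunc_B_Suc_low:
  assumes "n \<le> 5"
  shows "card (trunc (Suc n) ` B) = 2 * (card (trunc n ` B))\<^sup>2"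
proof -
  have "(\<lambda>g. (swaps g, trunc n (sec g False), trunc n (sec g True))) ` B
      = UNIV \<times> trunc n ` B \<times> trunc n ` B" (is "?f ` _ = _")
  proof (intro equalityI subsetI)
    fix z :: "bool \<times> (word \<Rightarrow> word) \<times> (word \<Rightarrow> word)"
    assume "z \<in> UNIV \<times> trunc n ` B \<times> trunc n ` B"
    then obtain s x y where xy: "x \<in> B" "y \<in> B" "z = (s, trunc n x, trunc n y)" by auto
    have adjust: "\<exists>b'\<in>B. trunc n b' = trunc n b \<and> parity 1 b' = parity 1 b \<and> parity 5 b' = p"
      if "b \<in> B" for b p
    proof (cases "parity 5 b = p")
      case False
      have "agree n gen_c0 id" using agree_le[OF _ _ c0_agree_id] assms by simp
      then have "agree n (gen_c0 \<circ> b) b"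
        by (simp add: agree_def tree_auts_length[OF B_tree_auts[OF that]])
      then show ?thesis using that False B_tree_auts[OF that]
        by (intro bexI[of _ "gen_c0 \<circ> b"])
          (simp_all add: parity_comp trunc_eq_iff del: parity.simps One_nat_def)
    qed (use that in auto)
    obtain x' where x': "x' \<in> B" "trunc n x' = trunc n x" "parity 1 x' = parity 1 x" "parity 5 x' = parity 1 y"
      using adjust[OF xy(1)] by metis
    obtain y' where y': "y' \<in> B" "trunc n y' = trunc n y" "parity 1 y' = parity 1 y" "parity 5 y' = parity 1 x"
      using adjust[OF xy(2)] by metis
    have t: "x' \<in> tree_auts" "y' \<in> tree_auts" using x' y' B_tree_auts by auto
    have "(if s then gen_a \<circ> tpair x' y' else tpair x' y') \<in> B"
      using x' y' by (intro B_assemble_sections) simp_all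
    then show "z \<in> ?f ` B"
      by (rule image_eqI[rotated]) (simp only: assemble_sections(2-4)[OF t] xy(3) x'(2) y'(2))
  qed (auto simp: B_sections)
  then show ?thesis
    using B_tree_auts by (simp add: subsetI card_trunc_Suc card_cartesian_product power2_eq_square)
qed

lemma card_trunc_translate:
  assumes "inj g"
  shows "card (trunc n ` (\<lambda>b. g \<circ> b) ` S) = card (trunc n ` S)"
proof -
  have "card ((\<lambda>b. trunc n (g \<circ> b)) ` S) = card (trunc n ` S)"
    by (rule card_image_cong_kernel) (auto simp: trunc_eq_iff agree_def inj_eq[OF assms])
  then show ?thesis by (simp add: image_image)
qed

definition B_parity :: "bool \<Rightarrow> bool \<Rightarrow> (word \<Rightarrow> word) set" where
  "B_parity i j = {b \<in> B. parity 1 b = i \<and> parity 5 b = j}"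

text \<open>
  The partners realise all four values of the parities, and translation by one of them carries one
  class to another.
\<close>
lemma card_trunc_B_parity: "card (trunc n ` B_parity i j) = card (trunc n ` B_parity False False)"
proof -
  let ?p = "partner j i"
  have pt: "?p \<in> tree_auts" using B_tree_auts by auto
  have inj: "inj ?p" using bij_tree_auts[OF pt] bij_is_inj by blast
  obtain p' where p': "p' \<in> B" "p' \<circ> ?p = id" "?p \<circ> p' = id" by (rule B_inverse[OF partner_B])
  have p't: "p' \<in> tree_auts" using p' B_tree_auts by auto
  have parp': "parity 1 p' = i" "parity 5 p' = j"
    using parity_comp[OF p't pt, of 1] parity_comp[OF p't pt, of 5] p'(2) parity_partner by (auto simp del: parity.simps One_nat_def)
  have "B_parity i j = (\<lambda>b. ?p \<circ> b) ` B_parity False False"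
  proof (intro equalityI subsetI)
    fix b assume b: "b \<in> B_parity i j"
    have "b = ?p \<circ> (p' \<circ> b)" using p'(3) by (simp flip: comp_assoc)
    moreover have "p' \<circ> b \<in> B_parity False False"
      using b p' parp' p't B_tree_auts by (simp add: B_parity_def parity_comp del: parity.simps One_nat_def)
    ultimately show "b \<in> (\<lambda>b. ?p \<circ> b) ` B_parity False False" by blast
  qed (auto simp: B_parity_def parity_comp pt B_tree_auts parity_partner simp del: parity.simps One_nat_def)
  then show ?thesis using card_trunc_translate[OF inj] by simp
qed

lemma card_UN_bool2:
  fixes X :: "bool \<Rightarrow> bool \<Rightarrow> 'a set"
  assumes "\<And>i j. finite (X i j)" "\<And>i j. card (X i j) = k"
    and "\<And>i j i' j' x. x \<in> X i j \<Longrightarrow> x \<in> X i' j' \<Longrightarrow> i = i' \<and> j = j'"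
  shows "card (\<Union>(i, j). X i j) = 4 * k"
proof -
  have "card (\<Union>p\<in>UNIV. (case p of (i, j) \<Rightarrow> X i j)) = (\<Sum>p\<in>UNIV. card (case p of (i, j) \<Rightarrow> X i j))"
    using assms(1) by (intro card_UN_disjoint) (auto simp: split_beta dest: assms(3))
  also have "\<dots> = (\<Sum>p\<in>(UNIV :: (bool \<times> bool) set). k)"
    using assms(2) by (simp add: split_beta)
  also have "\<dots> = 4 * k" by (simp add: card_cartesian_product UNIV_Times_UNIV[symmetric] del: UNIV_Times_UNIV)
  finally show ?thesis .
qed

lemma trunc_parity:
  assumes "6 \<le> n" "g \<in> B" "h \<in> B" "trunc n g = trunc n h"
  shows "parity 1 g = parity 1 h" "parity 5 g = parity 5 h"
  using assms parity_agree[of g h 1] parity_agree[of g h 5] agree_le[of g h n] B_tree_auts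
  by (simp_all add: trunc_eq_iff del: parity.simps One_nat_def)

text \<open>
  From level 6 on the action on the level determines the parities. The four classes have equal size
  \<open>k\<close>, and the class of one section determines that of the other: \<open>2 \<cdot> 4 \<cdot> k\<^sup>2 = (4 k)\<^sup>2 / 2\<close>.
\<close>
lemma card_trunc_B_Suc_high:
  assumes n: "6 \<le> n"
  shows "2 * card (trunc (Suc n) ` B) = (card (trunc n ` B))\<^sup>2"
proof -
  define k where "k = card (trunc n ` B_parity False False)"
  have sub: "B \<subseteq> tree_auts" using B_tree_auts by auto
  have fin: "finite (trunc n ` B_parity i j)" for i j
    by (rule finite_trunc) (use sub in \<open>auto simp: B_parity_def\<close>)
  have disj: "i = i' \<and> j = j'" if "x \<in> trunc n ` B_parity i j" "x \<in> trunc n ` B_parity i' j'" for x i j i' j'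
  proof -
    obtain b b' where "b \<in> B_parity i j" "b' \<in> B_parity i' j'" "trunc n b = trunc n b'"
      using \<open>x \<in> trunc n ` B_parity i j\<close> \<open>x \<in> trunc n ` B_parity i' j'\<close> by auto
    then show ?thesis using trunc_parity[OF n, of b b'] by (simp add: B_parity_def del: parity.simps One_nat_def)
  qed
  have "trunc n ` B = (\<Union>(i, j). trunc n ` B_parity i j)"
    by (auto simp: B_parity_def simp del: parity.simps One_nat_def)
  then have card_n: "card (trunc n ` B) = 4 * k"
    using card_UN_bool2[of "\<lambda>i j. trunc n ` B_parity i j" k] fin disj card_trunc_B_parity
    by (simp add: k_def)
  have "(\<lambda>g. (swaps g, trunc n (sec g False), trunc n (sec g True))) ` B
      = UNIV \<times> (\<Union>(i, j). trunc n ` B_parity i j \<times> trunc n ` B_parity j i)" (is "?f ` _ = _ \<times> ?U")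
  proof (intro equalityI subsetI)
    fix z assume "z \<in> ?f ` B"
    then obtain b where b: "b \<in> B" "z = ?f b" by auto
    have "sec b False \<in> B_parity (parity 1 (sec b False)) (parity 5 (sec b False))"
      "sec b True \<in> B_parity (parity 5 (sec b False)) (parity 1 (sec b False))"
      using B_sections[OF b(1), of False] B_sections[OF b(1), of True]
      by (auto simp: B_parity_def simp del: parity.simps One_nat_def)
    then show "z \<in> UNIV \<times> ?U" using b(2) by blast
  next
    fix z :: "bool \<times> (word \<Rightarrow> word) \<times> (word \<Rightarrow> word)"
    assume "z \<in> UNIV \<times> ?U"
    then obtain s i j x y where xy: "x \<in> B_parity i j" "y \<in> B_parity j i" "z = (s, trunc n x, trunc n y)" by auto
    have t: "x \<in> tree_auts" "y \<in> tree_auts" using xy sub by (auto simp: B_parity_def)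
    have "(if s then gen_a \<circ> tpair x y else tpair x y) \<in> B"
      using xy by (intro B_assemble_sections) (simp_all add: B_parity_def del: parity.simps One_nat_def)
    then show "z \<in> ?f ` B"
      by (rule image_eqI[rotated]) (simp only: assemble_sections(2-4)[OF t] xy(3))
  qed
  moreover have "card ?U = 4 * (k * k)"
  proof (rule card_UN_bool2)
    show "card (trunc n ` B_parity i j \<times> trunc n ` B_parity j i) = k * k" for i j
      by (simp add: card_cartesian_product card_trunc_B_parity[of n i j] card_trunc_B_parity[of n j i] k_def)
  next
    show "i = i' \<and> j = j'"
      if "z \<in> trunc n ` B_parity i j \<times> trunc n ` B_parity j i" "z \<in> trunc n ` B_parity i' j' \<times> trunc n ` B_parity j' i'"
      for i j i' j' z
      using that disj by (metis mem_Sigma_iff prod.collapse)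
  qed (use fin in auto)
  ultimately show ?thesis
    by (simp add: card_trunc_Suc[OF sub] card_cartesian_product card_n power2_eq_square)
qed

lemma card_trunc_B_low: "n \<le> 6 \<Longrightarrow> card (trunc n ` B) = 2 ^ (2 ^ n - 1)"
proof (rule card_full_recursion[where m = 6 and N = "\<lambda>n. card (trunc n ` B)"])
  show "card (trunc 0 ` B) = 1" using B_tree_auts B_id by (intro card_trunc_0) (blast, force)
qed (use card_trunc_B_Suc_low in auto)

lemma card_trunc_B_high: "card (trunc (6 + k) ` B) = 2 ^ (62 * 2 ^ k + 1)"
proof (induction k)
  case 0 then show ?case using card_trunc_B_low[of 6] by simp
next
  case (Suc k)
  have "2 * card (trunc (6 + Suc k) ` B) = (2 ^ (62 * 2 ^ k + 1))\<^sup>2"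
    using card_trunc_B_Suc_high[of "6 + k"] Suc by simp
  also have "\<dots> = 2 * 2 ^ (62 * 2 ^ Suc k + 1)"
    by (simp add: power2_eq_square flip: power_add)
  finally show ?case by simp
qed

section \<open>The metric of the level filtration\<close>

abbreviation tree_dist where "tree_dist \<equiv> filtration_dist AutT (level_stab tree_auts)"

text \<open>
  The distance of two automorphisms that agree on level \<open>n\<close> but not on level \<open>n + 1\<close>.
\<close>
definition level_dist :: "nat \<Rightarrow> real" where
  "level_dist n = 1 / 2 ^ (2 ^ n - 1)"

lemma r_coset_level_stab:
  assumes a: "a \<in> tree_auts"
  shows "level_stab tree_auts n #>\<^bsub>AutT\<^esub> a = {x \<in> tree_auts. agree n x a}"
proof (intro equalityI subsetI)
  fix x assume "x \<in> level_stab tree_auts n #>\<^bsub>AutT\<^esub> a"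
  then obtain h where h: "h \<in> tree_auts" "\<And>w. length w = n \<Longrightarrow> h w = w" "x = h \<circ> a"
    by (auto simp: r_coset_def level_stab_def)
  then show "x \<in> {x \<in> tree_auts. agree n x a}"
    using a by (auto simp: agree_def tree_auts_length[OF a] simp del: comp_apply) (simp add: tree_auts_length[OF a])
next
  fix x assume x: "x \<in> {x \<in> tree_auts. agree n x a}"
  let ?i = "inv\<^bsub>AutT\<^esub> a"
  have "(x \<circ> ?i) w = w" if "length w = n" for w
  proof -
    have "x (?i w) = a (?i w)" using x that AutT_inv(1)[OF a] by (simp add: agree_def tree_auts_length)
    also have "\<dots> = w" using AutT_inv(3)[OF a] by (metis comp_apply id_apply)
    finally show ?thesis by simp
  qed
  then have "x \<circ> ?i \<in> level_stab tree_auts n"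
    using x AutT_inv(1)[OF a] by (simp add: level_stab_def del: comp_apply)
  moreover have "x = (x \<circ> ?i) \<circ> a" using AutT_inv(2)[OF a] by (simp add: comp_assoc)
  ultimately show "x \<in> level_stab tree_auts n #>\<^bsub>AutT\<^esub> a"
    unfolding r_coset_def by auto
qed

lemma card_rcosets_level_stab:
  "card (rcosets\<^bsub>AutT\<^esub> (level_stab tree_auts n)) = 2 ^ (2 ^ n - 1)"
proof -
  have "rcosets\<^bsub>AutT\<^esub> (level_stab tree_auts n) = (\<lambda>a. {x \<in> tree_auts. agree n x a}) ` tree_auts"
    by (auto simp: RCOSETS_def r_coset_level_stab)
  also have "card \<dots> = card (trunc n ` tree_auts)"
  proof (rule card_image_cong_kernel)
    fix a b assume "a \<in> tree_auts" "b \<in> tree_auts"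
    then show "{x \<in> tree_auts. agree n x a} = {x \<in> tree_auts. agree n x b} \<longleftrightarrow> trunc n a = trunc n b"
      unfolding trunc_eq_iff by (blast intro: agree_refl agree_sym agree_trans)
  qed
  finally show ?thesis by (simp add: card_trunc_AutT)
qed

lemma tree_dist_eq:
  assumes g: "g \<in> tree_auts" and h: "h \<in> tree_auts"
  shows "tree_dist g h = Inf {level_dist n | n. agree n g h}"
proof -
  have "inv\<^bsub>AutT\<^esub> g \<circ> h \<in> level_stab tree_auts n \<longleftrightarrow> agree n g h" for n
  proof -
    have "(inv\<^bsub>AutT\<^esub> g \<circ> h) w = w \<longleftrightarrow> g w = h w" for w
      using AutT_inv(2,3)[OF g] by (metis comp_apply id_apply)
    then show ?thesis using AutT_inv(1)[OF g] h by (simp add: level_stab_def agree_def del: comp_apply)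
  qed
  then show ?thesis by (simp add: filtration_dist_def card_rcosets_level_stab level_dist_def)
qed

lemma level_dist_pos: "0 < level_dist n"
  by (simp add: level_dist_def)

lemma level_dist_antimono: "m \<le> n \<Longrightarrow> level_dist n \<le> level_dist m"
  unfolding level_dist_def by (intro divide_left_mono power_increasing diff_le_mono) auto

lemma level_dist_bdd: "bdd_below {level_dist n | n. agree n g h}"
  using level_dist_pos by (intro bdd_belowI[of _ 0]) (auto intro: less_imp_le)

lemma tree_dist_le: "g \<in> tree_auts \<Longrightarrow> h \<in> tree_auts \<Longrightarrow> agree n g h \<Longrightarrow> tree_dist g h \<le> level_dist n"
  unfolding tree_dist_eq by (rule cInf_lower[OF _ level_dist_bdd]) auto

lemma tree_dist_nonneg:
  assumes "g \<in> tree_auts" "h \<in> tree_auts"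
  shows "0 \<le> tree_dist g h"
  unfolding tree_dist_eq[OF assms] using agree_0[OF assms] level_dist_pos
  by (intro cInf_greatest) (auto intro: less_imp_le)

lemma tree_dist_ge:
  assumes "g \<in> tree_auts" "h \<in> tree_auts" "\<not> agree (Suc n) g h"
  shows "level_dist n \<le> tree_dist g h"
  unfolding tree_dist_eq[OF assms(1,2)]
proof (rule cInf_greatest)
  show "{level_dist n |n. agree n g h} \<noteq> {}" using agree_0[OF assms(1,2)] by blast
next
  fix r assume "r \<in> {level_dist n |n. agree n g h}"
  then obtain m where m: "r = level_dist m" "agree m g h" by auto
  then have "m \<le> n" using agree_le[OF assms(1,2) m(2), of "Suc n"] assms(3) by linarith
  then show "level_dist n \<le> r" using m level_dist_antimono by simp
qed

lemma diam_le:
  assumes "U \<subseteq> tree_auts" "\<And>x y. x \<in> U \<Longrightarrow> y \<in> U \<Longrightarrow> agree n x y"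
  shows "diam_wrt tree_dist U \<le> level_dist n"
proof (cases "U = {}")
  case False
  then have "(SUP (x, y) \<in> U \<times> U. tree_dist x y) \<le> level_dist n"
    using assms by (intro cSUP_least) (auto intro!: tree_dist_le simp: subset_iff)
  then show ?thesis using False by (simp add: diam_wrt_def)
qed (simp add: diam_wrt_def level_dist_pos less_imp_le)

lemma diam_upper:
  assumes "U \<subseteq> tree_auts" "x \<in> U" "y \<in> U"
  shows "tree_dist x y \<le> diam_wrt tree_dist U"
proof -
  have "bdd_above ((\<lambda>(x, y). tree_dist x y) ` (U \<times> U))"
    using assms(1) by (intro bdd_aboveI[of _ "level_dist 0"]) (auto intro!: tree_dist_le simp: subset_iff)
  then have "(\<lambda>(x, y). tree_dist x y) (x, y) \<le> (SUP (x, y) \<in> U \<times> U. tree_dist x y)"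
    using assms by (intro cSUP_upper) auto
  then show ?thesis using assms by (auto simp: diam_wrt_def)
qed

lemma diam_nonneg: "U \<subseteq> tree_auts \<Longrightarrow> 0 \<le> diam_wrt tree_dist U"
proof (cases "U = {}")
  case False
  assume U: "U \<subseteq> tree_auts"
  obtain x where "x \<in> U" using False by auto
  then show ?thesis using diam_upper[OF U, of x x] tree_dist_nonneg[of x x] U by fastforce
qed (simp add: diam_wrt_def)

section \<open>The closure of a set of automorphisms\<close>

lemma l_coset_level_stab:
  assumes a: "a \<in> tree_auts"
  shows "a <#\<^bsub>AutT\<^esub> level_stab tree_auts n = {x \<in> tree_auts. agree n a x}"
proof (intro equalityI subsetI)
  fix x assume "x \<in> a <#\<^bsub>AutT\<^esub> level_stab tree_auts n"
  then show "x \<in> {x \<in> tree_auts. agree n a x}"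
    using a by (auto simp: l_coset_def level_stab_def agree_def simp del: comp_apply) simp
next
  fix x assume x: "x \<in> {x \<in> tree_auts. agree n a x}"
  let ?i = "inv\<^bsub>AutT\<^esub> a"
  have "(?i \<circ> x) w = w" if "length w = n" for w
  proof -
    have "x w = a w" using x that by (simp add: agree_def)
    then show ?thesis using AutT_inv(2)[OF a] by (metis comp_apply id_apply)
  qed
  then have "?i \<circ> x \<in> level_stab tree_auts n"
    using x AutT_inv(1)[OF a] by (simp add: level_stab_def del: comp_apply)
  moreover have "x = a \<circ> (?i \<circ> x)" using AutT_inv(3)[OF a] by (simp flip: comp_assoc)
  ultimately show "x \<in> a <#\<^bsub>AutT\<^esub> level_stab tree_auts n"
    unfolding l_coset_def by auto
qed

lemma open_contains_coset:
  assumes "openin aut_topology T" "g \<in> T"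
  shows "\<exists>n. \<forall>h\<in>tree_auts. agree n g h \<longrightarrow> h \<in> T"
proof -
  have "generate_topology_on {a <#\<^bsub>AutT\<^esub> level_stab tree_auts n | a n. a \<in> carrier AutT} T"
    using assms(1) unfolding aut_topology_def openin_topology_generated_by_iff by simp
  then have "T \<subseteq> tree_auts \<and> (\<forall>g\<in>T. \<exists>n. \<forall>h\<in>tree_auts. agree n g h \<longrightarrow> h \<in> T)"
  proof induction
    case (Int S T)
    show ?case
    proof (intro conjI ballI)
      fix g assume g: "g \<in> S \<inter> T"
      then obtain m n where mn: "\<forall>h\<in>tree_auts. agree m g h \<longrightarrow> h \<in> S" "\<forall>h\<in>tree_auts. agree n g h \<longrightarrow> h \<in> T"
        using Int by blast
      have "g \<in> tree_auts" using Int g by blast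
      then have "\<forall>h\<in>tree_auts. agree (max m n) g h \<longrightarrow> h \<in> S \<inter> T"
        using mn agree_le[of g _ "max m n"] by auto
      then show "\<exists>n. \<forall>h\<in>tree_auts. agree n g h \<longrightarrow> h \<in> S \<inter> T" ..
    qed (use Int in blast)
  next
    case (UN K)
    then show ?case by (simp add: Union_iff) (meson Union_least)
  next
    case (Basis S)
    then obtain a n where a: "a \<in> tree_auts" "S = {x \<in> tree_auts. agree n a x}"
      using l_coset_level_stab by (auto simp del: comp_apply)
    then show ?case by (auto intro: agree_trans)
  qed auto
  then show ?thesis using assms(2) by blast
qed

lemma closure_of_eq:
  assumes "G \<subseteq> tree_auts"
  shows "aut_topology closure_of G = {g \<in> tree_auts. \<forall>n. \<exists>b\<in>G. agree n g b}"
proof (intro equalityI subsetI)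
  fix g assume g: "g \<in> aut_topology closure_of G"
  then have gt: "g \<in> tree_auts" using topspace_aut_topology by (auto simp: in_closure_of)
  moreover have "\<exists>b\<in>G. agree n g b" for n
  proof -
    have "openin aut_topology (g <#\<^bsub>AutT\<^esub> level_stab tree_auts n)"
      unfolding aut_topology_def using gt by (intro topology_generated_by_Basis) auto
    then have "openin aut_topology {x \<in> tree_auts. agree n g x}"
      by (simp add: l_coset_level_stab[OF gt])
    moreover have "g \<in> {x \<in> tree_auts. agree n g x}" using gt by simp
    ultimately have "\<exists>y. y \<in> G \<and> y \<in> {x \<in> tree_auts. agree n g x}"
      using g[unfolded in_closure_of, THEN conjunct2, THEN spec, of "{x \<in> tree_auts. agree n g x}"]
      by simp
    then show ?thesis by blast
  qed
  ultimately show "g \<in> {g \<in> tree_auts. \<forall>n. \<exists>b\<in>G. agree n g b}" by simp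
next
  fix g assume g: "g \<in> {g \<in> tree_auts. \<forall>n. \<exists>b\<in>G. agree n g b}"
  have "\<exists>y. y \<in> G \<and> y \<in> T" if "g \<in> T" "openin aut_topology T" for T
    using open_contains_coset[OF that(2,1)] g assms by blast
  then show "g \<in> aut_topology closure_of G"
    using g by (simp add: in_closure_of topspace_aut_topology)
qed

section \<open>Compactness and the share of a coset\<close>

text \<open>
  Completeness of \<open>Aut T\<close>: a coherent sequence of actions on the levels comes from an automorphism.
\<close>
lemma limit_tree_auts:
  assumes b: "\<And>n. b n \<in> tree_auts" and ag: "\<And>n. agree n (b n) (b (Suc n))"
  defines "g \<equiv> \<lambda>w. b (length w) w"
  shows "g \<in> tree_auts" "agree n g (b n)"
proof -
  have step: "agree m (b m) (b (m + k))" for m k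
  proof (induction k)
    case (Suc k)
    have "agree m (b (m + k)) (b (Suc (m + k)))"
      using agree_le[OF b b ag, of m "m + k"] by simp
    then show ?case using agree_trans[OF Suc] by simp
  qed simp
  have g: "g w = b n w" if "length w \<le> n" for w n
    using step[of "length w" "n - length w"] that by (simp add: agree_def g_def)
  show "agree n g (b n)" by (simp add: agree_def g)
  have both: "g u = b (max (length u) (length v)) u" "g v = b (max (length u) (length v)) v" for u v
    by (simp_all add: g)
  have "inj g" unfolding inj_def using both tree_auts_inj[OF b] by metis
  moreover have "\<exists>u. g u = v" for v
  proof -
    obtain u where u: "b (length v) u = v" using bij_tree_auts[OF b] by (metis bij_pointE)
    then have "length u = length v" using tree_auts_length[OF b] by metis
    then show ?thesis using u g[of u "length v"] by auto
  qed
  then have "surj g" unfolding surj_def by metis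
  moreover have "tree_adj (g u) (g v) \<longleftrightarrow> tree_adj u v" for u v
    using tree_auts_adj[OF b] both by metis
  moreover have "g [] = []" using tree_auts_Nil[OF b] by (simp add: g_def)
  ultimately show "g \<in> tree_auts" by (simp add: tree_auts_def bij_def)
qed

text \<open>
  Compactness of the closure of \<open>G\<close>, by the argument of Koenig's lemma. If no finite subfamily covers
  \<open>G\<close>, then, there being finitely many cosets of each level, a nested sequence of cosets can be chosen
  none of which is finitely covered. Its limit lies in one of the given cosets, which then covers a
  member of the sequence by itself.
\<close>
lemma finite_subcover:
  assumes G: "G \<subseteq> tree_auts"
    and cover: "\<And>g. g \<in> tree_auts \<Longrightarrow> \<forall>n. \<exists>b\<in>G. agree n g b \<Longrightarrow> \<exists>i\<in>J. agree (m i) (x i) g"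
  shows "\<exists>I\<subseteq>J. finite I \<and> (\<forall>b\<in>G. \<exists>i\<in>I. agree (m i) (x i) b)"
proof (rule ccontr)
  assume neg: "\<not> ?thesis"
  \<comment> \<open>No finite subfamily covers the coset of \<open>b\<close> of level \<open>n\<close>.\<close>
  define bad where "bad n b \<longleftrightarrow> b \<in> G \<and>
    (\<forall>I\<subseteq>J. finite I \<longrightarrow> (\<exists>b'\<in>G. agree n b b' \<and> (\<forall>i\<in>I. \<not> agree (m i) (x i) b')))" for n b
  have "\<exists>b0. bad 0 b0"
  proof -
    have "G \<noteq> {}" using neg by auto
    then obtain b0 where "b0 \<in> G" by blast
    then have "bad 0 b0" using neg G unfolding bad_def by (meson agree_0 subsetD)
    then show ?thesis by blast
  qed
  moreover have "\<exists>c. bad (Suc n) c \<and> agree n b c" if bad_b: "bad n b" for n b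
  proof (rule ccontr)
    assume no: "\<nexists>c. bad (Suc n) c \<and> agree n b c"
    define C where "C = trunc (Suc n) ` {c \<in> G. agree n b c}"
    \<comment> \<open>The elements of the class \<open>t\<close> in level \<open>n + 1\<close> are covered by the finite family \<open>I\<close>.\<close>
    define handles where "handles t I \<longleftrightarrow> I \<subseteq> J \<and> finite I \<and>
      (\<forall>b'\<in>G. trunc (Suc n) b' = t \<longrightarrow> (\<exists>i\<in>I. agree (m i) (x i) b'))" for t I
    have "\<exists>I. handles t I" if t: "t \<in> C" for t
    proof -
      obtain c where c: "c \<in> G" "agree n b c" "t = trunc (Suc n) c"
        using t unfolding C_def by blast
      then have "\<not> bad (Suc n) c" using no by blast
      then obtain I where I: "I \<subseteq> J" "finite I"
        "\<And>b'. b' \<in> G \<Longrightarrow> agree (Suc n) c b' \<Longrightarrow> \<exists>i\<in>I. agree (m i) (x i) b'"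
        using c(1) by (auto simp: bad_def)
      have "handles t I"
        unfolding handles_def c(3) trunc_eq_iff using I(1,2) by (auto intro!: I(3) agree_sym)
      then show ?thesis ..
    qed
    then obtain F where F: "\<And>t. t \<in> C \<Longrightarrow> handles t (F t)" by metis
    have "finite C" unfolding C_def using G by (intro finite_trunc) auto
    then have "(\<Union>t\<in>C. F t) \<subseteq> J" "finite (\<Union>t\<in>C. F t)"
      using F unfolding handles_def by (intro UN_least finite_UN_I; blast)+
    then obtain b' where b': "b' \<in> G" "agree n b b'" "\<forall>i\<in>(\<Union>t\<in>C. F t). \<not> agree (m i) (x i) b'"
      using bad_b unfolding bad_def by meson
    then have "trunc (Suc n) b' \<in> C" unfolding C_def by blast
    then show False using F[of "trunc (Suc n) b'"] b' unfolding handles_def by blast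
  qed
  ultimately obtain b where b: "\<And>n. bad n (b n) \<and> agree n (b n) (b (Suc n))"
    using dependent_nat_choice[of bad "\<lambda>n. agree n"] by metis
  have bG: "b n \<in> G" for n using b unfolding bad_def by blast
  have bt: "b n \<in> tree_auts" for n using bG G by blast
  define g where "g = (\<lambda>w. b (length w) w)"
  have g: "g \<in> tree_auts" "agree n g (b n)" for n
    using limit_tree_auts[of b] bt b unfolding g_def by blast+
  then obtain i where i: "i \<in> J" "agree (m i) (x i) g" using cover[of g] bG by blast
  have "\<exists>b'\<in>G. agree (m i) (b (m i)) b' \<and> (\<forall>j\<in>{i}. \<not> agree (m j) (x j) b')"
    using b[of "m i"] i(1) unfolding bad_def by blast
  then show False using i(2) g(2)[of "m i"] agree_trans by blast
qed

text \<open>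
  A coset of level \<open>n\<close> contains at most the share \<open>1 / |B\<^sub>n|\<close> of the elements of \<open>B\<^sub>N\<close>: the fibres of
  \<open>B\<^sub>N\<close> over \<open>B\<^sub>n\<close> are translates of each other.
\<close>
lemma card_trunc_fibre:
  assumes "n \<le> N" "x \<in> tree_auts"
  shows "card (trunc N ` {b \<in> B. agree n x b}) * card (trunc n ` B) \<le> card (trunc N ` B)"
proof (cases "{b \<in> B. agree n x b} = {}")
  case False
  define F where "F c = trunc N ` {b \<in> B. trunc n b = c}" for c
  have sub: "B \<subseteq> tree_auts" using B_tree_auts by auto
  have card_F: "card (F (trunc n c)) = card (F (trunc n id))" if c: "c \<in> B" for c
  proof -
    have ct: "c \<in> tree_auts" using c sub by auto
    have inj: "inj c" using bij_tree_auts[OF ct] bij_is_inj by blast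
    obtain c' where c': "c' \<in> B" "c' \<circ> c = id" "c \<circ> c' = id" by (rule B_inverse[OF c])
    have "{b \<in> B. trunc n b = trunc n c} = (\<lambda>b. c \<circ> b) ` {b \<in> B. trunc n b = trunc n id}"
    proof (intro equalityI subsetI)
      fix b assume b: "b \<in> {b \<in> B. trunc n b = trunc n c}"
      have "c' (b w) = w" if "length w = n" for w
      proof -
        have "b w = c w" using b that by (simp add: trunc_eq_iff agree_def)
        then show ?thesis using c'(2) by (metis comp_apply id_apply)
      qed
      then have "trunc n (c' \<circ> b) = trunc n id" by (simp add: trunc_eq_iff agree_def)
      moreover have "b = c \<circ> (c' \<circ> b)" using c'(3) by (simp flip: comp_assoc)
      ultimately show "b \<in> (\<lambda>b. c \<circ> b) ` {b \<in> B. trunc n b = trunc n id}" using b c'(1) by auto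
    next
      fix b assume "b \<in> (\<lambda>b. c \<circ> b) ` {b \<in> B. trunc n b = trunc n id}"
      then obtain d where "d \<in> B" "agree n d id" "b = c \<circ> d" by (auto simp: trunc_eq_iff)
      then show "b \<in> {b \<in> B. trunc n b = trunc n c}" using c by (simp add: trunc_eq_iff agree_def)
    qed
    then show ?thesis unfolding F_def using card_trunc_translate[OF inj] by simp
  qed
  have finF: "finite (F c)" for c unfolding F_def by (rule finite_trunc) (use sub in auto)
  have "trunc N ` B = (\<Union>c\<in>trunc n ` B. F c)" by (auto simp: F_def)
  also have "card \<dots> = (\<Sum>c\<in>trunc n ` B. card (F c))"
  proof (rule card_UN_disjoint)
    show "\<forall>c\<in>trunc n ` B. \<forall>d\<in>trunc n ` B. c \<noteq> d \<longrightarrow> F c \<inter> F d = {}"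
    proof (intro ballI impI)
      fix c d :: "word \<Rightarrow> word" assume "c \<noteq> d"
      have "trunc n b = trunc n b'" if "b \<in> B" "b' \<in> B" "trunc N b = trunc N b'" for b b'
        using that agree_le[of b b' N n] assms(1) sub by (auto simp: trunc_eq_iff)
      then show "F c \<inter> F d = {}" using \<open>c \<noteq> d\<close> unfolding F_def by auto
    qed
  qed (use finite_trunc[OF sub] finF in auto)
  also have "\<dots> = (\<Sum>c\<in>trunc n ` B. card (F (trunc n id)))"
    by (rule sum.cong) (use card_F in blast)+
  also have "\<dots> = card (trunc n ` B) * card (F (trunc n id))"
    by simp
  finally have total: "card (trunc N ` B) = card (trunc n ` B) * card (F (trunc n id))" .
  obtain c where c: "c \<in> B" "agree n x c" using False by auto
  have "{b \<in> B. agree n x b} = {b \<in> B. trunc n b = trunc n c}"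
    using c by (auto simp: trunc_eq_iff intro: agree_trans agree_sym)
  then have "card (trunc N ` {b \<in> B. agree n x b}) = card (F (trunc n id))"
    using card_F[OF c(1)] by (simp add: F_def)
  then show ?thesis using total by simp
next
  case True
  then show ?thesis by (simp only: image_empty card.empty mult_0 le0)
qed

lemma card_trunc_B_pos: "0 < card (trunc n ` B)"
  using finite_trunc[of B n] B_tree_auts B_id unfolding card_gt_0_iff by blast

lemma cosets_covering_B_mass:
  assumes I: "finite I" and x: "\<And>i. i \<in> I \<Longrightarrow> x i \<in> tree_auts"
    and cover: "\<forall>b\<in>B. \<exists>i\<in>I. agree (m i) (x i) b"
  shows "1 \<le> (\<Sum>i\<in>I. 1 / real (card (trunc (m i) ` B)))"
proof -
  define N where "N = (\<Sum>i\<in>I. m i)"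
  have N: "m i \<le> N" if "i \<in> I" for i
    unfolding N_def using member_le_sum[OF that, of m] I by simp
  have "trunc N ` B = (\<Union>i\<in>I. trunc N ` {b \<in> B. agree (m i) (x i) b})" using cover by blast
  then have "card (trunc N ` B) \<le> (\<Sum>i\<in>I. card (trunc N ` {b \<in> B. agree (m i) (x i) b}))"
    by (simp only: card_UN_le[OF I])
  then have "real (card (trunc N ` B)) \<le> (\<Sum>i\<in>I. real (card (trunc N ` {b \<in> B. agree (m i) (x i) b})))"
    by (simp only: of_nat_le_iff flip: of_nat_sum)
  also have "\<dots> \<le> (\<Sum>i\<in>I. real (card (trunc N ` B)) * (1 / real (card (trunc (m i) ` B))))"
  proof (rule sum_mono)
    fix i assume i: "i \<in> I"
    have "real (card (trunc N ` {b \<in> B. agree (m i) (x i) b}) * card (trunc (m i) ` B)) \<le> real (card (trunc N ` B))"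
      using card_trunc_fibre[OF N[OF i] x[OF i]] by (simp only: of_nat_le_iff)
    then show "real (card (trunc N ` {b \<in> B. agree (m i) (x i) b}))
        \<le> real (card (trunc N ` B)) * (1 / real (card (trunc (m i) ` B)))"
      using card_trunc_B_pos[of "m i"] by (simp add: field_simps)
  qed
  also have "\<dots> = real (card (trunc N ` B)) * (\<Sum>i\<in>I. 1 / real (card (trunc (m i) ` B)))"
    by (simp add: sum_distrib_left)
  finally show ?thesis using card_trunc_B_pos[of N] by simp
qed

section \<open>The two bounds for the dimension\<close>

lemma level_dist_powr: "level_dist n powr s = 2 powr (- (real (2 ^ n - 1) * s))"
proof -
  have "level_dist n = 2 powr (- real (2 ^ n - 1))"
    by (simp only: level_dist_def powr_minus powr_realpow[OF zero_less_numeral] divide_inverse mult_1)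
  then show ?thesis by (simp only: powr_powr mult_minus_left)
qed

text \<open>
  Beyond level 6 this is \<open>(64 \<cdot> 2\<^sup>k - 1) s \<le> 62 \<cdot> 2\<^sup>k + 1\<close>, and before it \<open>|B\<^sub>n| = |Aut T : St(n)|\<close>.
\<close>
lemma inverse_card_B_le:
  assumes "0 < s" "s \<le> 31 / 32"
  shows "1 / real (card (trunc n ` B)) \<le> level_dist n powr s"
proof (cases "n \<le> 6")
  case True
  have "1 / real (card (trunc n ` B)) = level_dist n powr 1"
    using True level_dist_pos[of n] by (simp add: card_trunc_B_low level_dist_def)
  also have "\<dots> \<le> level_dist n powr s"
    using assms level_dist_pos[of n] level_dist_antimono[of 0 n] by (intro powr_mono') (auto simp: level_dist_def)
  finally show ?thesis .
next
  case False
  define k where "k = n - 6"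
  have n: "n = 6 + k" using False by (simp add: k_def)
  have e: "real (2 ^ n - 1) = 64 * 2 ^ k - 1" by (simp add: n power_add of_nat_diff)
  have "(64 * 2 ^ k - 1) * s \<le> (64 * 2 ^ k - 1) * (31 / 32)"
    using assms by (intro mult_left_mono) (auto intro: order_trans[OF one_le_power[of "2::real" k]])
  then have "- (62 * 2 ^ k + 1) \<le> - (real (2 ^ n - 1) * s)" unfolding e by simp
  then have "2 powr (- (62 * 2 ^ k + 1)) \<le> level_dist n powr s"
    unfolding level_dist_powr by (intro powr_mono) auto
  moreover have "1 / real (card (trunc n ` B)) = 2 powr (- (62 * 2 ^ k + 1))"
  proof -
    have "real (card (trunc n ` B)) = 2 powr real (62 * 2 ^ k + 1)"
      unfolding n card_trunc_B_high by (subst powr_realpow) simp_all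
    then show ?thesis by (simp only: powr_minus divide_inverse mult_1) (simp add: add.commute)
  qed
  ultimately show ?thesis by simp
qed

text \<open>
  Replaces a set of a cover by a coset that contains it, at the cost of an error \<open>e\<close>. The error is
  used for a set of diameter 0 only: it has no largest level, and a coset of sufficiently high level is
  taken.
\<close>
lemma exists_level_of_set:
  assumes U: "U \<subseteq> tree_auts" and s: "0 < s" "s \<le> 31 / 32" and e: "0 < e"
  shows "\<exists>n. (\<forall>x\<in>U. \<forall>y\<in>U. agree n x y) \<and> 1 / real (card (trunc n ` B)) \<le> diam_wrt tree_dist U powr s + e"
proof (cases "\<forall>n. \<forall>x\<in>U. \<forall>y\<in>U. agree n x y")
  case True
  obtain k where k: "(1 / 2) ^ k < e" using real_arch_pow_inv[OF e, of "1 / 2"] by auto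
  have "k \<le> 62 * 2 ^ k + 1" using less_exp[of k] by linarith
  then have "(2::real) ^ k \<le> 2 ^ (62 * 2 ^ k + 1)" by (intro power_increasing) auto
  then have "1 / real (card (trunc (6 + k) ` B)) \<le> (1 / 2) ^ k"
    unfolding card_trunc_B_high power_one_over of_nat_power of_nat_numeral
    by (intro divide_left_mono) auto
  then have "1 / real (card (trunc (6 + k) ` B)) \<le> diam_wrt tree_dist U powr s + e"
    using k powr_ge_zero[of "diam_wrt tree_dist U" s] by linarith
  then show ?thesis using True by blast
next
  case False
  define n where "n = (LEAST n. \<not> (\<forall>x\<in>U. \<forall>y\<in>U. agree n x y))"
  have n: "\<not> (\<forall>x\<in>U. \<forall>y\<in>U. agree n x y)"
    unfolding n_def by (rule LeastI_ex) (use False in simp)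
  have least: "\<forall>x\<in>U. \<forall>y\<in>U. agree k x y" if "k < n" for k
    using not_less_Least[OF that[unfolded n_def]] by blast
  have "agree 0 x y" if "x \<in> U" "y \<in> U" for x y
    using that U by (intro agree_0) auto
  then have "n \<noteq> 0" using n by metis
  then obtain k where k: "n = Suc k" using not0_implies_Suc by blast
  obtain x y where xy: "x \<in> U" "y \<in> U" "\<not> agree (Suc k) x y" using n k by blast
  have "level_dist k \<le> diam_wrt tree_dist U" using tree_dist_ge[OF _ _ xy(3)] diam_upper[OF U xy(1,2)] xy U by force
  then have "level_dist k powr s \<le> diam_wrt tree_dist U powr s"
    using level_dist_pos[of k] s by (intro powr_mono2) auto
  then have "1 / real (card (trunc k ` B)) \<le> diam_wrt tree_dist U powr s + e"
    using inverse_card_B_le[OF s, of k] e by linarith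
  then show ?thesis using least[of k] k by blast
qed

abbreviation Bbar where "Bbar \<equiv> aut_topology closure_of B"

lemma Bbar_eq: "Bbar = {g \<in> tree_auts. \<forall>n. \<exists>b\<in>B. agree n g b}"
  by (rule closure_of_eq) (use B_tree_auts in auto)

text \<open>
  The errors of replacing the sets of the cover by cosets are chosen as a geometric series with sum
  \<open>1/2\<close>, so that they use up at most half of the total share 1.
\<close>
lemma cover_sum_ge_half:
  assumes s: "0 < s" "s \<le> 31 / 32"
    and U: "\<And>i. U i \<subseteq> tree_auts" and cover: "Bbar \<subseteq> (\<Union>i::nat. U i)"
  shows "ennreal (1 / 2) \<le> (\<Sum>i. ennreal (diam_wrt tree_dist (U i) powr s))"
proof -
  define J where "J = {i. U i \<noteq> {}}"
  define x where "x i = (SOME g. g \<in> U i)" for i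
  have x: "x i \<in> U i" if "i \<in> J" for i using that unfolding J_def x_def by (simp add: some_in_eq)
  have "\<forall>i. \<exists>n. (\<forall>x\<in>U i. \<forall>y\<in>U i. agree n x y) \<and>
      1 / real (card (trunc n ` B)) \<le> diam_wrt tree_dist (U i) powr s + (1 / 2) ^ (i + 2)"
    using exists_level_of_set[OF U s] by simp
  then obtain m where m: "\<And>i y z. y \<in> U i \<Longrightarrow> z \<in> U i \<Longrightarrow> agree (m i) y z"
    "\<And>i. 1 / real (card (trunc (m i) ` B)) \<le> diam_wrt tree_dist (U i) powr s + (1 / 2) ^ (i + 2)"
    by metis
  have "\<exists>i\<in>J. agree (m i) (x i) g" if "g \<in> tree_auts" "\<forall>n. \<exists>b\<in>B. agree n g b" for g
  proof -
    have "g \<in> Bbar" using that by (simp add: Bbar_eq)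
    then obtain i where i: "g \<in> U i" using cover by blast
    then have "i \<in> J" by (auto simp: J_def)
    then show ?thesis using m(1)[OF x i] by blast
  qed
  then obtain I where I: "I \<subseteq> J" "finite I" "\<forall>b\<in>B. \<exists>i\<in>I. agree (m i) (x i) b"
    using finite_subcover[of B J m x] B_tree_auts by blast
  have "1 \<le> (\<Sum>i\<in>I. 1 / real (card (trunc (m i) ` B)))"
    using I x U by (intro cosets_covering_B_mass) blast+
  also have "\<dots> \<le> (\<Sum>i\<in>I. diam_wrt tree_dist (U i) powr s + (1 / 2) ^ (i + 2))"
    by (rule sum_mono) (rule m(2))
  also have "\<dots> = (\<Sum>i\<in>I. diam_wrt tree_dist (U i) powr s) + (\<Sum>i\<in>I. (1 / 2) ^ (i + 2))"
    by (rule sum.distrib)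
  also have "(\<Sum>i\<in>I. (1 / 2 :: real) ^ (i + 2)) \<le> 1 / 2"
  proof -
    have sums: "(\<lambda>i. (1 / 2 :: real) ^ (i + 2)) sums (1 / 2)"
      using sums_mult[OF geometric_sums[of "1 / 2 :: real"], of "1 / 4"] by (simp add: power_add field_simps)
    show ?thesis
      using sum_le_suminf[OF sums_summable[OF sums] I(2)] sums_unique[OF sums] by simp
  qed
  finally have "1 / 2 \<le> (\<Sum>i\<in>I. diam_wrt tree_dist (U i) powr s)" by simp
  then have "ennreal (1 / 2) \<le> ennreal (\<Sum>i\<in>I. diam_wrt tree_dist (U i) powr s)" by (rule ennreal_leI)
  also have "\<dots> = (\<Sum>i\<in>I. ennreal (diam_wrt tree_dist (U i) powr s))" by (simp add: sum_ennreal)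
  also have "\<dots> \<le> (\<Sum>i. ennreal (diam_wrt tree_dist (U i) powr s))"
    using I(2) by (intro sum_le_suminf) auto
  finally show ?thesis .
qed

lemma hausdorff_measure_pos:
  assumes "0 < s" "s \<le> 31 / 32"
  shows "hausdorff_measure tree_auts tree_dist s Bbar \<noteq> 0"
proof -
  have "ennreal (1 / 2) \<le> (INF U \<in> delta_covers tree_auts tree_dist 1 Bbar. \<Sum>i. ennreal (diam_wrt tree_dist (U i) powr s))"
    by (rule INF_greatest) (use cover_sum_ge_half[OF assms] in \<open>auto simp: delta_covers_def\<close>)
  also have "\<dots> \<le> hausdorff_measure tree_auts tree_dist s Bbar"
    unfolding hausdorff_measure_def by (rule SUP_upper) simp
  finally show ?thesis by auto
qed

lemma level_cover:
  assumes "level_dist n \<le> \<delta>" "0 \<le> s"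
  shows "(INF U \<in> delta_covers tree_auts tree_dist \<delta> Bbar. \<Sum>i. ennreal (diam_wrt tree_dist (U i) powr s))
    \<le> ennreal (real (card (trunc n ` B)) * level_dist n powr s)"
proof -
  define K where "K = card (trunc n ` B)"
  have "finite (trunc n ` B)" using finite_trunc B_tree_auts by blast
  then obtain e where e: "bij_betw e {0..<K} (trunc n ` B)"
    unfolding K_def using ex_bij_betw_nat_finite by blast
  define U where "U i = (if i < K then {g \<in> tree_auts. trunc n g = e i} else {})" for i
  have U: "U i \<subseteq> tree_auts" for i by (auto simp: U_def)
  have ag: "agree n x y" if "x \<in> U i" "y \<in> U i" for x y i
    using that by (auto simp: U_def simp flip: trunc_eq_iff split: if_splits)
  have "Bbar \<subseteq> (\<Union>i. U i)"
  proof
    fix g assume "g \<in> Bbar"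
    then obtain b where b: "g \<in> tree_auts" "b \<in> B" "agree n g b" unfolding Bbar_eq by blast
    then have "trunc n g \<in> e ` {0..<K}" using e by (auto simp: bij_betw_def simp flip: trunc_eq_iff)
    then show "g \<in> (\<Union>i. U i)" using b(1) by (auto simp: U_def)
  qed
  moreover have "tree_dist x y \<le> \<delta>" if "x \<in> U i" "y \<in> U i" for x y i
    using tree_dist_le[OF _ _ ag[OF that]] U that assms(1) by (meson order_trans subsetD)
  ultimately have "U \<in> delta_covers tree_auts tree_dist \<delta> Bbar" using U by (auto simp: delta_covers_def)
  then have "(INF U \<in> delta_covers tree_auts tree_dist \<delta> Bbar. \<Sum>i. ennreal (diam_wrt tree_dist (U i) powr s))
    \<le> (\<Sum>i. ennreal (diam_wrt tree_dist (U i) powr s))" by (rule INF_lower)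
  also have "\<dots> = (\<Sum>i<K. ennreal (diam_wrt tree_dist (U i) powr s))"
    by (rule suminf_finite) (auto simp: U_def diam_wrt_def)
  also have "\<dots> \<le> (\<Sum>i<K. ennreal (level_dist n powr s))"
    using diam_le[OF U ag] diam_nonneg[OF U] assms(2)
    by (intro sum_mono ennreal_leI powr_mono2) auto
  also have "\<dots> = ennreal (real K * level_dist n powr s)"
    by (simp add: ennreal_mult ennreal_of_nat_eq_real_of_nat)
  finally show ?thesis by (simp add: K_def)
qed

lemma level_dist_le: "level_dist n \<le> (1 / 2) ^ n"
proof -
  have "n \<le> 2 ^ n - 1" using less_exp[of n] by linarith
  then have "(2::real) ^ n \<le> 2 ^ (2 ^ n - 1)" by (intro power_increasing) auto
  then show ?thesis by (simp add: level_dist_def power_one_over divide_simps)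
qed

lemma level_cover_mass_tendsto_0:
  assumes s: "31 / 32 < s"
  shows "(\<lambda>k. real (card (trunc (6 + k) ` B)) * level_dist (6 + k) powr s) \<longlonglongrightarrow> 0"
proof -
  have eq: "real (card (trunc (6 + k) ` B)) * level_dist (6 + k) powr s
      = 2 powr ((62 - 64 * s) * 2 ^ k + (1 + s))" for k
  proof -
    have e: "real (2 ^ (6 + k) - 1) = 64 * 2 ^ k - 1" by (simp add: power_add of_nat_diff)
    have "real (card (trunc (6 + k) ` B)) = 2 powr real (62 * 2 ^ k + 1)"
      unfolding card_trunc_B_high by (subst powr_realpow) simp_all
    then show ?thesis unfolding level_dist_powr e by (simp add: algebra_simps flip: powr_add)
  qed
  have "(\<lambda>k. 2 powr (- c * 2 ^ k + (1 + s))) \<longlonglongrightarrow> 0" if "0 < c" for c :: real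
    using that by real_asymp
  from this[of "64 * s - 62"] show ?thesis unfolding eq using s by simp
qed

lemma hausdorff_measure_zero:
  assumes s: "31 / 32 < s"
  shows "hausdorff_measure tree_auts tree_dist s Bbar = 0"
proof -
  have "(INF U \<in> delta_covers tree_auts tree_dist \<delta> Bbar. \<Sum>i. ennreal (diam_wrt tree_dist (U i) powr s)) \<le> 0"
    if \<delta>: "0 < \<delta>" for \<delta>
  proof (rule ennreal_le_epsilon)
    fix e :: real assume e: "0 < e"
    have "(\<lambda>k. (1 / 2 :: real) ^ (6 + k)) \<longlonglongrightarrow> 0" by real_asymp
    then have "\<forall>\<^sub>F k in sequentially. (1 / 2) ^ (6 + k) < \<delta>" using \<delta> by (rule order_tendstoD)
    moreover have "\<forall>\<^sub>F k in sequentially. real (card (trunc (6 + k) ` B)) * level_dist (6 + k) powr s < e"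
      using level_cover_mass_tendsto_0[OF s] e by (rule order_tendstoD)
    ultimately obtain k where k: "(1 / 2) ^ (6 + k) < \<delta>"
      "real (card (trunc (6 + k) ` B)) * level_dist (6 + k) powr s < e"
      using eventually_happens[OF eventually_conj] by force
    have level_dist: "level_dist (6 + k) \<le> \<delta>" using level_dist_le[of "6 + k"] k(1) by linarith
    have "(INF U \<in> delta_covers tree_auts tree_dist \<delta> Bbar. \<Sum>i. ennreal (diam_wrt tree_dist (U i) powr s))
        \<le> ennreal (real (card (trunc (6 + k) ` B)) * level_dist (6 + k) powr s)"
      by (rule level_cover[OF level_dist]) (use s in simp)
    also have "\<dots> \<le> ennreal e" using k(2) by (intro ennreal_leI) simp
    finally show "(INF U \<in> delta_covers tree_auts tree_dist \<delta> Bbar. \<Sum>i. ennreal (diam_wrt tree_dist (U i) powr s))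
        \<le> 0 + ennreal e" by simp
  qed
  then have "hausdorff_measure tree_auts tree_dist s Bbar \<le> 0"
    unfolding hausdorff_measure_def by (intro SUP_least) auto
  then show ?thesis by simp
qed

theorem proposition3p6:
  shows "hausdorff_dim_AutT (aut_topology closure_of second_Basilica_GE) = ereal (31 / 32)"
proof -
  let ?S = "{s. 0 < s \<and> hausdorff_measure tree_auts tree_dist s Bbar = 0}"
  have "?S = {31 / 32 <..}"
  proof (intro equalityI subsetI)
    fix s assume "s \<in> ?S"
    then show "s \<in> {31 / 32 <..}" using hausdorff_measure_pos[of s] by (simp, linarith)
  qed (use hausdorff_measure_zero in auto)
  moreover have "Inf (ereal ` {31 / 32 <..}) = ereal (31 / 32)"
  proof (rule antisym)
    show "Inf (ereal ` {31 / 32 <..}) \<le> ereal (31 / 32)"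
      by (rule ereal_le_epsilon2) (auto intro!: Inf_lower)
  qed (auto intro: Inf_greatest)
  ultimately show ?thesis by (simp add: hausdorff_dim_AutT_def hausdorff_dim_def)
qed

end
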